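(* For any integers $d\geqslant n\geqslant 2$, $$X_n^{2^d-1}x_n^{2^d}\simeq_{n}\sum_{(i;I)\in\mathcal N_{n-1}}\phi_{(i;I\cup n)}(X^{2^d-1})\,x_n^{2^d}.$$
   Context: $P_n=\mathbb F_2[x_1,\ldots,x_n]$, $\deg x_i=1$, is a module over the mod-2 Steenrod algebra $\mathcal A$ in the usual way ($Sq^0=\mathrm{id}$, $Sq^1(x_i)=x_i^2$, $Sq^k(x_i)=0$ for $k>1$, Cartan formula). $X_j=\prod_{1\leqslant m\leqslant n,\,m\ne j}x_m\in P_n$ for $1\leqslant j\leqslant n$, and $X=x_1x_2\cdots x_{n-1}\in P_{n-1}$. For a monomial $x=x_1^{a_1}\cdots x_n^{a_n}$ write $\nu_t(x)=a_t$. For $a\geqslant 0$, $\alpha_i(a)\in\{0,1\}$ is the $i$-th dyadic digit, $a=\sum_{i\geqslant 0}\alpha_i(a)2^i$. The weight vector of $x$ is $\omega(x)=(\omega_1(x),\omega_2(x),\ldots)$ with $\omega_i(x)=\sum_j\alpha_{i-1}(\nu_j(x))$. Weight vectors (eventually zero sequences of non-negative integers) are ordered left lexicographically, and $\deg\omega=\sum_{i>0}2^{i-1}\omega_i$. $P_n^-(\omega)$ is the span of all monomials $y\in P_n$ with $\deg y=\deg\omega$ and $\omega(y)<\omega$. $\mathcal A_s^+$ is the span of all $Sq^j$ with $1\leqslant j<2^s$. For $f,g\in P_n$ of the same degree, $f\simeq_{(s,\omega)}g$ means $f-g\in\mathcal A_s^+P_n+P_n^-(\omega)$; for a monomial $x$,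 $x\simeq_s g$ means $x\simeq_{(s,\omega(x))}g$. $\mathcal N_m=\{(i;I): I=(i_1,\ldots,i_r),\ 1\leqslant i<i_1<\cdots<i_r\leqslant m,\ 0\leqslant r<m\}$; $\mathcal N_{n-1}\subset\mathcal N_n$. $\ell(I)=r$ is the length of $I$. $I\cup n$ is the increasing sequence whose set of entries is that of $I$ together with $n$. For $1\leqslant i\leqslant n$, $f_i:P_{n-1}\to P_n$ is the algebra homomorphism with $f_i(x_j)=x_j$ for $j<i$ and $f_i(x_j)=x_{j+1}$ for $i\leqslant j<n$. Let $(i;I)\in\mathcal N_n$ with $r=\ell(I)>0$ and $1\leqslant u\leqslant r$. A monomial $x\in P_{n-1}$ is $u$-compatible with $(i;I)$ if: (i) $\nu_{i_1-1}(x)=\cdots=\nu_{i_{u-1}-1}(x)=2^r-1$; (ii) $\nu_{i_u-1}(x)>2^r-1$; (iii) $\alpha_{r-t}(\nu_{i_u-1}(x))=1$ for $1\leqslant t\leqslant u$; (iv) $\alpha_{r-t}(\nu_{i_t-1}(x))=1$ for $u<t\leqslant r$. (At most one such $u$ exists.) Put $x_{(I,u)}=x_{i_u}^{2^{r-1}+\cdots+2^{r-u}}\prod_{u<t\leqslant r}x_{i_t}^{2^{r-t}}$. The $\mathbb F_2$-linear map $\phi_{(i;I)}:P_{n-1}\to P_n$ is given on monomials by $\phi_{(i;I)}(x)=x_i^{2^r-1}f_i(x)/x_{(I,u)}$ if $x$ is $u$-compatible with $(i;I)$ for some $u$, and $\phi_{(i;I)}(x)=0$ otherwise; $\phi_{(i;\emptyset)}=f_i$.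 *)

theory Defs
  imports
    "HOL-Library.Poly_Mapping"
    "HOL-Library.Z2"
    "HOL-Computational_Algebra.Polynomial"
begin

section \<open>Polynomials over the field with two elements\<close>

type_synonym expo = "nat \<Rightarrow>\<^sub>0 nat"

text \<open>All the rings \<open>P\<^sub>n\<close> sit in one ring of polynomials in the variables \<open>x\<^sub>i\<close>, \<open>i :: nat\<close>;
  \<open>P\<^sub>n\<close> is the subring generated by \<open>x\<^sub>1, \<dots>, x\<^sub>n\<close>. The type \<open>bit\<close> of the library is the field
  with two elements.\<close>

type_synonym mpoly2 = "expo \<Rightarrow>\<^sub>0 bit"

definition mon :: "expo \<Rightarrow> mpoly2" where
  "mon m = Poly_Mapping.single m 1"

definition var :: "nat \<Rightarrow> mpoly2" where
  "var i = mon (Poly_Mapping.single i 1)"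

definition P :: "nat \<Rightarrow> mpoly2 set" where
  "P n = {f. \<forall>m \<in> Poly_Mapping.keys f. Poly_Mapping.keys m \<subseteq> {1..n}}"

definition mdeg :: "expo \<Rightarrow> nat" where
  "mdeg m = (\<Sum>j \<in> Poly_Mapping.keys m. Poly_Mapping.lookup m j)"

definition homogeneous :: "nat \<Rightarrow> mpoly2 \<Rightarrow> bool" where
  "homogeneous e f \<longleftrightarrow> (\<forall>m \<in> Poly_Mapping.keys f. mdeg m = e)"

definition scale2 :: "bit \<Rightarrow> mpoly2 \<Rightarrow> mpoly2" where
  "scale2 c f = Poly_Mapping.single 0 c * f"

global_interpretation F2: vector_space scale2
proof
  fix a b :: bit and x y :: mpoly2
  show "scale2 a (x + y) = scale2 a x + scale2 a y"
    by (simp only: scale2_def distrib_left)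
  show "scale2 (a + b) x = scale2 a x + scale2 b x"
    by (simp only: scale2_def single_add distrib_right)
  show "scale2 a (scale2 b x) = scale2 (a * b) x"
    by (simp only: scale2_def mult_single add_0 flip: mult.assoc)
  show "scale2 1 x = x"
    by (simp add: scale2_def)
qed

text \<open>The algebra homomorphism that maps \<open>x\<^sub>j\<close> to \<open>g j\<close> and is \<open>h\<close> on the coefficients.\<close>

definition eval_hom :: "(bit \<Rightarrow> 'b::comm_ring_1) \<Rightarrow> (nat \<Rightarrow> 'b) \<Rightarrow> mpoly2 \<Rightarrow> 'b" where
  "eval_hom h g f = (\<Sum>m \<in> Poly_Mapping.keys f.
     h (Poly_Mapping.lookup f m) *
     (\<Prod>j \<in> Poly_Mapping.keys m. g j ^ Poly_Mapping.lookup m j))"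

lemma mon_0 [simp]: "mon 0 = 1"
  by (simp add: mon_def)

lemma mon_add: "mon (a + b) = mon a * mon b"
  by (simp add: mon_def mult_single)

lemma mon_sum: "mon (sum e A) = (\<Prod>a\<in>A. mon (e a))"
  by (induction A rule: infinite_finite_induct) (simp_all add: mon_add)

lemma var_power: "var i ^ k = mon (Poly_Mapping.single i k)"
proof (induction k)
  case (Suc k)
  then show ?case
    by (simp add: var_def flip: mon_add single_add)
qed simp

lemma keys_mon [simp]: "Poly_Mapping.keys (mon m) = {m}"
  by (simp add: mon_def)

lemma expo_sum: "(\<Sum>j \<in> Poly_Mapping.keys m. Poly_Mapping.single j (Poly_Mapping.lookup m j)) = m"
  for m :: "'a \<Rightarrow>\<^sub>0 'b::comm_monoid_add"
proof (rule poly_mapping_eqI)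
  fix k
  have "(\<Sum>j \<in> Poly_Mapping.keys m. Poly_Mapping.lookup (Poly_Mapping.single j (Poly_Mapping.lookup m j)) k)
      = (\<Sum>j \<in> Poly_Mapping.keys m. if j = k then Poly_Mapping.lookup m k else 0)"
    by (intro sum.cong) (auto simp: lookup_single when_def)
  then show "Poly_Mapping.lookup (\<Sum>j \<in> Poly_Mapping.keys m. Poly_Mapping.single j (Poly_Mapping.lookup m j)) k
     = Poly_Mapping.lookup m k"
    by (simp add: lookup_sum in_keys_iff)
qed

lemma mon_conv_prod: "mon m = (\<Prod>j \<in> Poly_Mapping.keys m. var j ^ Poly_Mapping.lookup m j)"
  by (simp add: var_power expo_sum flip: mon_sum)

lemma mpoly2_conv_sum: "f = (\<Sum>m \<in> Poly_Mapping.keys f. mon m)" for f :: mpoly2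
proof -
  have "mon m = Poly_Mapping.single m (Poly_Mapping.lookup f m)" if "m \<in> Poly_Mapping.keys f" for m
    using that by (simp add: mon_def in_keys_iff)
  then show ?thesis
    using expo_sum[of f] by simp
qed

lemma mpoly2_add_self [simp]: "f + f = 0" for f :: mpoly2
proof (rule poly_mapping_eqI)
  fix k show "Poly_Mapping.lookup (f + f) k = Poly_Mapping.lookup 0 k"
    by (simp only: lookup_add lookup_zero) (cases "Poly_Mapping.lookup f k"; simp)
qed

lemma mpoly2_induct [case_names one var add mult]:
  assumes one: "Q 1" and var: "\<And>i. Q (var i)"
    and add: "\<And>f g. Q f \<Longrightarrow> Q g \<Longrightarrow> Q (f + g)"
    and mult: "\<And>f g. Q f \<Longrightarrow> Q g \<Longrightarrow> Q (f * g)"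
  shows "Q f"
proof -
  have pow: "Q (var j ^ k)" for j k
    by (induction k) (auto intro: one var mult)
  have prd: "Q (\<Prod>j\<in>A. var j ^ e j)" for A and e :: "nat \<Rightarrow> nat"
    by (induction A rule: infinite_finite_induct) (auto intro: one pow mult)
  have "Q 0"
    using add[OF one one] by simp
  then have "Q (\<Sum>m\<in>A. mon m)" for A
    by (induction A rule: infinite_finite_induct) (auto intro: add prd simp: mon_conv_prod)
  then show ?thesis
    by (subst mpoly2_conv_sum)
qed

context
  fixes h :: "bit \<Rightarrow> 'b::comm_ring_1" and g :: "nat \<Rightarrow> 'b"
  assumes h0: "h 0 = 0" and h1: "h 1 = 1" and hadd: "\<And>a b. h (a + b) = h a + h b"
begin

lemma eval_hom_superset:
  assumes "finite A" "Poly_Mapping.keys f \<subseteq> A"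
  shows "eval_hom h g f = (\<Sum>m \<in> A. h (Poly_Mapping.lookup f m) *
     (\<Prod>j \<in> Poly_Mapping.keys m. g j ^ Poly_Mapping.lookup m j))"
  unfolding eval_hom_def using assms
  by (intro sum.mono_neutral_left) (auto simp: in_keys_iff h0 simp del: bit_not_zero_iff)

lemma eval_hom_add: "eval_hom h g (p + q) = eval_hom h g p + eval_hom h g q"
proof -
  let ?A = "Poly_Mapping.keys p \<union> Poly_Mapping.keys q"
  have *: "eval_hom h g f = (\<Sum>m \<in> ?A. h (Poly_Mapping.lookup f m) *
     (\<Prod>j \<in> Poly_Mapping.keys m. g j ^ Poly_Mapping.lookup m j))"
    if "Poly_Mapping.keys f \<subseteq> ?A" for f
    using that by (intro eval_hom_superset) auto
  have "Poly_Mapping.keys (p + q) \<subseteq> ?A" "Poly_Mapping.keys p \<subseteq> ?A" "Poly_Mapping.keys q \<subseteq> ?A"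
    using keys_add[of p q] by auto
  then show ?thesis
    by (simp only: * lookup_add hadd distrib_right sum.distrib)
qed

lemma eval_hom_0: "eval_hom h g 0 = 0"
  by (simp add: eval_hom_def)

lemma eval_hom_sum: "eval_hom h g (sum p A) = (\<Sum>a\<in>A. eval_hom h g (p a))"
  by (induction A rule: infinite_finite_induct) (simp_all add: eval_hom_0 eval_hom_add)

lemma eval_hom_mon:
  "eval_hom h g (mon m) = (\<Prod>j \<in> Poly_Mapping.keys m. g j ^ Poly_Mapping.lookup m j)"
  by (simp add: eval_hom_def) (simp add: mon_def h1)

lemma eval_hom_1: "eval_hom h g 1 = 1"
  using eval_hom_mon[of 0] by simp

lemma eval_hom_var: "eval_hom h g (var i) = g i"
  by (simp add: var_def eval_hom_mon)

lemma eval_hom_mon_mult: "eval_hom h g (mon a * mon b) = eval_hom h g (mon a) * eval_hom h g (mon b)"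
proof -
  let ?A = "Poly_Mapping.keys a \<union> Poly_Mapping.keys b"
  have sup: "(\<Prod>j \<in> Poly_Mapping.keys m. g j ^ Poly_Mapping.lookup m j)
     = (\<Prod>j \<in> ?A. g j ^ Poly_Mapping.lookup m j)" if "Poly_Mapping.keys m \<subseteq> ?A" for m
    using that by (intro prod.mono_neutral_left) (auto simp: in_keys_iff)
  have "eval_hom h g (mon a * mon b) = (\<Prod>j \<in> ?A. g j ^ Poly_Mapping.lookup (a + b) j)"
    by (simp only: eval_hom_mon sup[OF keys_add] flip: mon_add)
  also have "\<dots> = (\<Prod>j \<in> ?A. g j ^ Poly_Mapping.lookup a j) * (\<Prod>j \<in> ?A. g j ^ Poly_Mapping.lookup b j)"
    by (simp only: lookup_add power_add prod.distrib)
  also have "\<dots> = eval_hom h g (mon a) * eval_hom h g (mon b)"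
    using sup[of a] sup[of b] by (simp add: eval_hom_mon)
  finally show ?thesis .
qed

lemma eval_hom_mult: "eval_hom h g (p * q) = eval_hom h g p * eval_hom h g q"
proof -
  have "eval_hom h g ((\<Sum>a\<in>A. mon a) * (\<Sum>b\<in>B. mon b))
      = eval_hom h g (\<Sum>a\<in>A. mon a) * eval_hom h g (\<Sum>b\<in>B. mon b)" for A B
    by (simp add: sum_product eval_hom_sum eval_hom_mon_mult)
  then show ?thesis
    by (metis mpoly2_conv_sum)
qed

end


section \<open>The action of the Steenrod algebra\<close>

text \<open>Over \<open>\<bbbF>\<^sub>2\<close> additive maps are linear.\<close>

definition steenrod_action :: "(nat \<Rightarrow> mpoly2 \<Rightarrow> mpoly2) \<Rightarrow> bool" where
  "steenrod_action S \<longleftrightarrow>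
     (\<forall>k f g. S k (f + g) = S k f + S k g) \<and>
     (\<forall>f. S 0 f = f) \<and>
     (\<forall>i. S 1 (var i) = var i ^ 2) \<and>
     (\<forall>i. \<forall>k > 1. S k (var i) = 0) \<and>
     (\<forall>k f g. S k (f * g) = (\<Sum>j\<le>k. S j f * S (k - j) g))"

text \<open>The total square \<open>\<Sum>\<^sub>k Sq\<^sup>k t\<^sup>k\<close> as a ring homomorphism into polynomials in \<open>t\<close>.\<close>

definition total_Sq :: "mpoly2 \<Rightarrow> mpoly2 poly" where
  "total_Sq = eval_hom (\<lambda>c. [:Poly_Mapping.single 0 c:]) (\<lambda>i. [:var i, var i ^ 2:])"

lemma steenrod_action_total_Sq: "steenrod_action (\<lambda>k f. coeff (total_Sq f) k)"
proof -
  let ?h = "\<lambda>c::bit. [:Poly_Mapping.single 0 c :: mpoly2:]"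
  let ?g = "\<lambda>i. [:var i, var i ^ 2:]"
  have h: "?h 0 = 0" "?h 1 = 1" "\<And>a b. ?h (a + b) = ?h a + ?h b"
    by (simp, simp add: one_pCons, simp only: single_add add_pCons add_0)
  have add: "total_Sq (f + g) = total_Sq f + total_Sq g"
    and mult: "total_Sq (f * g) = total_Sq f * total_Sq g"
    and one: "total_Sq 1 = 1" and var: "total_Sq (var i) = ?g i" for f g i
    unfolding total_Sq_def
    by (rule eval_hom_add[OF h] eval_hom_mult[OF h] eval_hom_1[OF h] eval_hom_var[OF h])+
  have "coeff (total_Sq f) 0 = f" for f
    by (induction f rule: mpoly2_induct) (simp_all add: add mult one var coeff_mult)
  moreover have "coeff (?g i) k = 0" if "k > 1" for i k
    using that by (intro coeff_eq_0) (auto intro: le_less_trans[OF degree_pCons_le])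
  ultimately show ?thesis
    unfolding steenrod_action_def by (simp add: add mult var coeff_mult)
qed

lemma steenrod_action_one:
  assumes "steenrod_action S" "k > 0"
  shows "S k 1 = 0"
  using \<open>k > 0\<close>
proof (induction k rule: less_induct)
  case (less k)
  have "S k (1 * 1) = (\<Sum>j\<le>k. S j 1 * S (k - j) 1)"
    using assms(1) by (simp only: steenrod_action_def)
  also have "\<dots> = (\<Sum>j\<in>{0,k}. S j 1 * S (k - j) 1)"
  proof (intro sum.mono_neutral_right ballI)
    fix j assume "j \<in> {..k} - {0,k}"
    then have "S j 1 = 0" using less.IH[of j] by auto
    then show "S j 1 * S (k - j) 1 = 0" by simp
  qed auto
  also have "\<dots> = S k 1 + S k 1"
    using less.prems assms(1) by (simp add: steenrod_action_def)
  finally show ?case by simp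
qed

lemma steenrod_action_unique:
  assumes S: "steenrod_action S" and T: "steenrod_action T"
  shows "S = T"
proof -
  have "\<forall>k. S k f = T k f" for f
  proof (induction f rule: mpoly2_induct)
    case one
    then show ?case
      using steenrod_action_one[OF S] steenrod_action_one[OF T] S T
      by (metis steenrod_action_def gr0I)
  next
    case (var i)
    have "S k (var i) = T k (var i)" for k
    proof -
      consider "k = 0" | "k = 1" | "k > 1" by linarith
      then show ?thesis using S T by cases (auto simp: steenrod_action_def)
    qed
    then show ?case by simp
  next
    case (add f g)
    then show ?case using S T by (simp add: steenrod_action_def)
  next
    case (mult f g)
    then show ?case using S T by (simp add: steenrod_action_def)
  qed
  then show ?thesis by (intro ext) simp
qed

definition Sq :: "nat \<Rightarrow> mpoly2 \<Rightarrow> mpoly2" where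
  "Sq = (THE S. steenrod_action S)"

lemma Sq_eq: "Sq = (\<lambda>k f. coeff (total_Sq f) k)"
  unfolding Sq_def by (rule the_equality) (auto intro: steenrod_action_total_Sq steenrod_action_unique)

lemma steenrod_action_Sq: "steenrod_action Sq"
  by (simp add: Sq_eq steenrod_action_total_Sq)

definition A_plus_P :: "nat \<Rightarrow> nat \<Rightarrow> mpoly2 set" where
  "A_plus_P s n = F2.span {Sq j f | j f. 1 \<le> j \<and> j < 2 ^ s \<and> f \<in> P n}"


section \<open>Weight vectors\<close>

definition digit :: "nat \<Rightarrow> nat \<Rightarrow> nat" where
  "digit i a = a div 2 ^ i mod 2"

text \<open>Weight vectors are elements of \<^typ>\<open>nat \<Rightarrow>\<^sub>0 nat\<close> with the indices shifted by one: the value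
  at \<open>k\<close> is \<open>\<omega>\<^sub>k\<^sub>+\<^sub>1\<close>. The order of the library on this type is the left lexicographic one.\<close>

lift_definition weight :: "expo \<Rightarrow> (nat \<Rightarrow>\<^sub>0 nat)" is
  "\<lambda>a k. \<Sum>j \<in> {j. a j \<noteq> 0}. digit k (a j)"
proof -
  fix a :: "nat \<Rightarrow> nat"
  assume fin: "finite {j. a j \<noteq> 0}"
  define N where "N = (\<Sum>j \<in> {j. a j \<noteq> 0}. a j)"
  have "{k. (\<Sum>j \<in> {j. a j \<noteq> 0}. digit k (a j)) \<noteq> 0} \<subseteq> {..N}"
  proof (rule subsetI, rule ccontr)
    fix k assume k: "k \<in> {k. (\<Sum>j \<in> {j. a j \<noteq> 0}. digit k (a j)) \<noteq> 0}" "k \<notin> {..N}"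
    have "digit k (a j) = 0" if "j \<in> {j. a j \<noteq> 0}" for j
    proof -
      have "a j \<le> N" unfolding N_def using that fin by (intro member_le_sum) auto
      also have "N < k" using k by simp
      also have "k < 2 ^ k" by simp
      finally show ?thesis by (simp add: digit_def)
    qed
    then show False using k(1) by simp
  qed
  then show "finite {k. (\<Sum>j \<in> {j. a j \<noteq> 0}. digit k (a j)) \<noteq> 0}"
    by (rule finite_subset) simp
qed

lemma lookup_weight:
  "Poly_Mapping.lookup (weight m) k = (\<Sum>j \<in> Poly_Mapping.keys m. digit k (Poly_Mapping.lookup m j))"
  by transfer simp

lemma weight_less_iff:
  "v < w \<longleftrightarrow> (\<exists>k. Poly_Mapping.lookup v k < Poly_Mapping.lookup w k \<and>
     (\<forall>k' < k. Poly_Mapping.lookup v k' = Poly_Mapping.lookup w k'))" for v w :: "nat \<Rightarrow>\<^sub>0 nat"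
  by transfer (simp add: less_fun_def)

definition wdeg :: "(nat \<Rightarrow>\<^sub>0 nat) \<Rightarrow> nat" where
  "wdeg w = (\<Sum>k \<in> Poly_Mapping.keys w. 2 ^ k * Poly_Mapping.lookup w k)"

definition P_minus :: "nat \<Rightarrow> (nat \<Rightarrow>\<^sub>0 nat) \<Rightarrow> mpoly2 set" where
  "P_minus n w = F2.span {mon m | m. mon m \<in> P n \<and> mdeg m = wdeg w \<and> weight m < w}"

text \<open>The relation \<open>f \<simeq>\<^sub>(\<^sub>s\<^sub>,\<^sub>w\<^sub>) g\<close> on homogeneous elements of \<open>P\<^sub>n\<close> of the same degree.\<close>

definition equiv_weight :: "nat \<Rightarrow> nat \<Rightarrow> (nat \<Rightarrow>\<^sub>0 nat) \<Rightarrow> mpoly2 \<Rightarrow> mpoly2 \<Rightarrow> bool" where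
  "equiv_weight n s w f g \<longleftrightarrow>
     f \<in> P n \<and> g \<in> P n \<and> (\<exists>e. homogeneous e f \<and> homogeneous e g) \<and>
     f - g \<in> {a + b | a b. a \<in> A_plus_P s n \<and> b \<in> P_minus n w}"

text \<open>The relation \<open>x \<simeq>\<^sub>s g\<close>, whose left-hand side is a monomial.\<close>

definition equiv_mon :: "nat \<Rightarrow> nat \<Rightarrow> mpoly2 \<Rightarrow> mpoly2 \<Rightarrow> bool" where
  "equiv_mon n s x g \<longleftrightarrow> (\<exists>m. x = mon m \<and> equiv_weight n s (weight m) x g)"


section \<open>The index sets and the maps between polynomial rings\<close>

definition N_set :: "nat \<Rightarrow> (nat \<times> nat list) set" where
  "N_set m = {(i, I). 1 \<le> i \<and> sorted_wrt (<) (i # I) \<and> (\<forall>j \<in> set (i # I). j \<le> m) \<and> length I < m}"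

lemma finite_N_set: "finite (N_set m)"
proof (rule finite_subset)
  show "N_set m \<subseteq> {..m} \<times> {I. set I \<subseteq> {..m} \<and> length I \<le> m}"
    by (auto simp: N_set_def)
  show "finite ({..m} \<times> {I. set I \<subseteq> {..m} \<and> length I \<le> m})"
    by (intro finite_cartesian_product finite_lists_length_le) auto
qed

definition adjoin :: "nat list \<Rightarrow> nat \<Rightarrow> nat list" where
  "adjoin I n = sorted_list_of_set (insert n (set I))"

text \<open>\<open>f\<^sub>i\<close>; its restriction to \<open>P\<^sub>n\<^sub>-\<^sub>1\<close> does not depend on \<open>n\<close>.\<close>

definition f_map :: "nat \<Rightarrow> mpoly2 \<Rightarrow> mpoly2" where
  "f_map i = eval_hom (\<lambda>c. Poly_Mapping.single 0 c) (\<lambda>j. if j < i then var j else var (j + 1))"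

lemma
  shows f_map_add: "f_map i (p + q) = f_map i p + f_map i q"
    and f_map_mult: "f_map i (p * q) = f_map i p * f_map i q"
    and f_map_1: "f_map i 1 = 1"
    and f_map_var: "f_map i (var j) = (if j < i then var j else var (j + 1))"
    and f_map_mon: "f_map i (mon m) =
      (\<Prod>j \<in> Poly_Mapping.keys m. (if j < i then var j else var (j + 1)) ^ Poly_Mapping.lookup m j)"
proof -
  let ?h = "\<lambda>c::bit. Poly_Mapping.single 0 c :: mpoly2"
  have h: "?h 0 = 0" "?h 1 = 1" "\<And>a b. ?h (a + b) = ?h a + ?h b"
    by (simp, simp, rule single_add)
  show "f_map i (p + q) = f_map i p + f_map i q"
    unfolding f_map_def by (rule eval_hom_add[OF h])
  show "f_map i (p * q) = f_map i p * f_map i q"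
    unfolding f_map_def by (rule eval_hom_mult[OF h])
  show "f_map i 1 = 1"
    unfolding f_map_def by (rule eval_hom_1[OF h])
  show "f_map i (var j) = (if j < i then var j else var (j + 1))"
    unfolding f_map_def by (rule eval_hom_var[OF h])
  show "f_map i (mon m) =
      (\<Prod>j \<in> Poly_Mapping.keys m. (if j < i then var j else var (j + 1)) ^ Poly_Mapping.lookup m j)"
    unfolding f_map_def by (rule eval_hom_mon[OF h])
qed

text \<open>The entry \<open>i\<^sub>t\<close> of \<open>I\<close> is \<open>I ! (t - 1)\<close>.\<close>

definition compatible :: "nat \<Rightarrow> nat list \<Rightarrow> expo \<Rightarrow> bool" where
  "compatible u I m \<longleftrightarrow> (let r = length I; \<nu> = (\<lambda>t. Poly_Mapping.lookup m (I ! (t - 1) - 1)) in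
     1 \<le> u \<and> u \<le> r \<and>
     (\<forall>t. 1 \<le> t \<and> t \<le> u - 1 \<longrightarrow> \<nu> t = 2 ^ r - 1) \<and>
     \<nu> u > 2 ^ r - 1 \<and>
     (\<forall>t. 1 \<le> t \<and> t \<le> u \<longrightarrow> digit (r - t) (\<nu> u) = 1) \<and>
     (\<forall>t. u < t \<and> t \<le> r \<longrightarrow> digit (r - t) (\<nu> t) = 1))"

lemma compatible_unique:
  assumes "compatible u I m" "compatible v I m"
  shows "u = v"
proof (rule ccontr)
  assume "u \<noteq> v"
  then consider "u < v" | "v < u" by linarith
  then show False
    by cases (use assms in \<open>fastforce simp: compatible_def Let_def\<close>)+
qed

text \<open>The exponent of the monomial \<open>x\<^sub>(\<^sub>I\<^sub>,\<^sub>u\<^sub>)\<close>.\<close>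

definition x_Iu :: "nat list \<Rightarrow> nat \<Rightarrow> expo" where
  "x_Iu I u = (let r = length I in
     Poly_Mapping.single (I ! (u - 1)) (\<Sum>t=1..u. 2 ^ (r - t)) +
     (\<Sum>t \<in> {u<..r}. Poly_Mapping.single (I ! (t - 1)) (2 ^ (r - t))))"

text \<open>Division by the monomial with exponent \<open>e\<close>, meaningful only if it divides \<open>f\<close>.\<close>

definition mdiv :: "mpoly2 \<Rightarrow> expo \<Rightarrow> mpoly2" where
  "mdiv f e = (\<Sum>m \<in> Poly_Mapping.keys f. mon (m - e))"

definition phi_mon :: "nat \<Rightarrow> nat list \<Rightarrow> expo \<Rightarrow> mpoly2" where
  "phi_mon i I m =
     (if I = [] then f_map i (mon m)
      else if \<exists>u. compatible u I m
      then mdiv (var i ^ (2 ^ length I - 1) * f_map i (mon m)) (x_Iu I (THE u. compatible u I m))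
      else 0)"

lemma phi_mon_mult:
  assumes I: "sorted_wrt (<) (i # I)" and i: "1 \<le> i" and u: "compatible u I m"
  shows "phi_mon i I m * mon (x_Iu I u) = var i ^ (2 ^ length I - 1) * f_map i (mon m)"
proof -
  define r where "r = length I"
  define E where "E = (\<Sum>j \<in> Poly_Mapping.keys m.
    Poly_Mapping.single (if j < i then j else j + 1) (Poly_Mapping.lookup m j))"
  define F where "F = Poly_Mapping.single i (2 ^ r - 1) + E"
  have "f_map i (mon m) = mon E"
    unfolding f_map_mon E_def mon_sum by (intro prod.cong) (auto simp: var_power)
  then have F: "var i ^ (2 ^ length I - 1) * f_map i (mon m) = mon F"
    by (simp add: F_def r_def mon_add var_power)
  have u1: "1 \<le> u" "u \<le> r" and u2: "Poly_Mapping.lookup m (I ! (u - 1) - 1) > 2 ^ r - 1"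
    and u3: "\<And>t. u < t \<Longrightarrow> t \<le> r \<Longrightarrow> digit (r - t) (Poly_Mapping.lookup m (I ! (t - 1) - 1)) = 1"
    using u by (auto simp: compatible_def Let_def r_def)
  have "distinct I"
    using I strict_sorted_iff by auto
  have E_ge: "Poly_Mapping.lookup m (k - 1) \<le> Poly_Mapping.lookup E k" if "k \<in> set I" for k
  proof (cases "k - 1 \<in> Poly_Mapping.keys m")
    case True
    have "i < k" using I that by auto
    then have "Poly_Mapping.lookup m (k - 1) =
      Poly_Mapping.lookup (Poly_Mapping.single (if k - 1 < i then k - 1 else k - 1 + 1) (Poly_Mapping.lookup m (k - 1))) k"
      by auto
    also have "\<dots> \<le> Poly_Mapping.lookup E k"
      unfolding E_def lookup_sum using True by (intro member_le_sum) auto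
    finally show ?thesis .
  qed (simp add: in_keys_iff)
  have geo: "(\<Sum>t=1..v. 2 ^ (r - t)) + 2 ^ (r - v) = (2::nat) ^ r" if "v \<le> r" for v
    using that
  proof (induction v)
    case (Suc v)
    then have "r - v = Suc (r - Suc v)" by simp
    then show ?case using Suc by simp
  qed simp
  have le: "Poly_Mapping.lookup (x_Iu I u) k \<le> Poly_Mapping.lookup F k" for k
  proof -
    have x: "Poly_Mapping.lookup (x_Iu I u) k =
       (if I ! (u - 1) = k then \<Sum>t=1..u. 2 ^ (r - t) else 0) +
       (\<Sum>t \<in> {u<..r}. if I ! (t - 1) = k then 2 ^ (r - t) else 0)"
      by (simp only: x_Iu_def Let_def r_def lookup_add lookup_sum lookup_single when_def)
    show ?thesis
    proof (cases "k \<in> set I")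
      case False
      then have "I ! (t - 1) \<noteq> k" if "1 \<le> t" "t \<le> r" for t
        using that by (auto simp: r_def in_set_conv_nth)
      then have "Poly_Mapping.lookup (x_Iu I u) k = 0"
        using u1 unfolding x by (auto intro!: sum.neutral)
      then show ?thesis by simp
    next
      case True
      then obtain s' where "s' < r" "I ! s' = k"
        by (auto simp: r_def in_set_conv_nth)
      then obtain s where s: "1 \<le> s" "s \<le> r" "I ! (s - 1) = k"
        by (metis Suc_leI diff_Suc_1 le_add1 plus_1_eq_Suc)
      have iff: "I ! (t - 1) = k \<longleftrightarrow> t = s" if "1 \<le> t" "t \<le> r" for t
        using that s \<open>distinct I\<close> nth_eq_iff_index_eq[of I "t - 1" "s - 1"] by (auto simp: r_def)
      have "(\<Sum>t \<in> {u<..r}. if I ! (t - 1) = k then 2 ^ (r - t) else 0)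
          = (\<Sum>t \<in> {u<..r}. if t = s then 2 ^ (r - s) else (0::nat))"
      proof (intro sum.cong refl)
        fix t assume "t \<in> {u<..r}"
        then have "1 \<le> t" "t \<le> r" by auto
        from iff[OF this] show "(if I ! (t - 1) = k then 2 ^ (r - t) else 0) = (if t = s then 2 ^ (r - s) else (0::nat))"
          by auto
      qed
      then have x': "Poly_Mapping.lookup (x_Iu I u) k =
         (if u = s then \<Sum>t=1..u. 2 ^ (r - t) else 0) + (if u < s then 2 ^ (r - s) else 0)"
        using u1 s unfolding x iff[OF u1] by simp
      have "Poly_Mapping.lookup (x_Iu I u) k \<le> Poly_Mapping.lookup m (k - 1)"
      proof -
        consider "u = s" | "u < s" | "u > s" by linarith
        then show ?thesis
        proof cases
          case 1
          have "(\<Sum>t=1..u. 2 ^ (r - t)) \<le> (2::nat) ^ r - 1"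
            using geo[OF u1(2)] by (metis add_diff_cancel_right' diff_le_mono2 one_le_numeral one_le_power)
          then show ?thesis using 1 u2 s(3) x' by simp
        next
          case 2
          then have "digit (r - s) (Poly_Mapping.lookup m (k - 1)) = 1"
            using u3[of s] s by simp
          then have "2 ^ (r - s) \<le> Poly_Mapping.lookup m (k - 1)"
            unfolding digit_def by (rule_tac ccontr) simp
          then show ?thesis using 2 x' by simp
        qed (simp add: x')
      qed
      also have "\<dots> \<le> Poly_Mapping.lookup F k"
        using E_ge[OF True] by (simp add: F_def lookup_add)
      finally show ?thesis .
    qed
  qed
  have "F - x_Iu I u + x_Iu I u = F"
    by (rule poly_mapping_eqI) (simp add: lookup_add lookup_minus le)
  then have *: "mdiv (mon F) (x_Iu I u) * mon (x_Iu I u) = mon F"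
    by (simp add: mdiv_def flip: mon_add)
  have "I \<noteq> []"
    using u1 by (auto simp: r_def)
  moreover have "(THE u. compatible u I m) = u"
    using u compatible_unique by blast
  ultimately have "phi_mon i I m = mdiv (mon F) (x_Iu I u)"
    unfolding phi_mon_def F using u by (simp only: if_False) (auto simp: exI[of _ u])
  then show ?thesis
    by (simp only: * F)
qed

definition phi :: "nat \<Rightarrow> nat list \<Rightarrow> mpoly2 \<Rightarrow> mpoly2" where
  "phi i I f = (\<Sum>m \<in> Poly_Mapping.keys f. phi_mon i I m)"

definition XX :: "nat \<Rightarrow> nat \<Rightarrow> mpoly2" where
  "XX n j = (\<Prod>m \<in> {1..n} - {j}. var m)"

end

theory Submission
  imports Defs
begin

text \<open>
  Write a monomial as the list of its dyadic rows: row \<open>t\<close> is the set of the \<open>j\<close> with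
  \<open>\<alpha>\<^sub>t(\<nu>\<^sub>j) = 1\<close>. Every monomial of the statement has rows \<open>{1..n} - {c\<^sub>t}\<close> for \<open>t < d\<close> and
  \<open>{e}\<close> in row \<open>d\<close>; denote it by \<open>(c\<^sub>0, \<dots>, c\<^sub>d\<^sub>-\<^sub>1; e)\<close>. The left-hand side is \<open>(n, \<dots>, n; n)\<close> and
  the summand of \<open>(i; I)\<close> is \<open>(n, i\<^sub>r, \<dots>, i\<^sub>1, i, \<dots>, i; n)\<close>.

  Applying \<open>Sq\<^sup>1\<close> to a monomial whose first \<open>k\<close> rows are full gives, modulo smaller weights, the two
  relations \<open>\<Sum>\<^sub>j (j, \<dots>, j; j) \<simeq> 0\<close> and \<open>(a\<^sup>k, b, q; e) \<simeq> (b\<^sup>k, a, q; e)\<close>. The map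
  \<open>f \<mapsto> (\<Prod>\<^sub>a\<^sub>\<in>\<^sub>A x\<^sub>a) f\<^sup>2\<close>, which inserts a row in front, sends hits by \<open>Sq\<^sup>j\<close> to hits by
  \<open>Sq\<^sup>2\<^sup>j\<close> modulo smaller weights, so both relations hold behind any prefix of length less than \<open>n\<close>.

  By the second relation, for fixed \<open>e\<close>, the class of the sequences needed here depends only on the
  set of their entries. Sum the first relation over the decreasing prefixes \<open>C \<subseteq> {1..n-1}\<close>. For \<open>j < n\<close>
  the terms of \<open>C\<close> and \<open>C \<union> {j}\<close> cancel, and the terms with \<open>j = n\<close> are the two sides of the claim:
  \<open>C = {}\<close> gives the left-hand side and \<open>C = {i, i\<^sub>1, \<dots>, i\<^sub>r}\<close> the summand of \<open>(i; I)\<close>.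
\<close>

section \<open>Exponents and weights\<close>

text \<open>For finite \<open>A\<close>, \<open>mon (ind A)\<close> is the square-free monomial on
  \<open>A\<close>, and \<open>ind A + (m + m)\<close> has lowest dyadic row \<open>A\<close> with
  the rows of \<open>m\<close> shifted up by one.\<close>

definition ind :: "nat set \<Rightarrow> expo" where
  "ind A = (\<Sum>a\<in>A. Poly_Mapping.single a 1)"

lemma lookup_ind: "finite A \<Longrightarrow> Poly_Mapping.lookup (ind A) j = of_bool (j \<in> A)"
  by (simp add: ind_def lookup_sum lookup_single when_def)

lemma keys_ind: "finite A \<Longrightarrow> Poly_Mapping.keys (ind A) = A"
  by (auto simp: in_keys_iff lookup_ind)

lemma ind_singleton: "ind {a} = Poly_Mapping.single a 1"
  by (simp add: ind_def)

lemma ind_insert: "finite A \<Longrightarrow> a \<notin> A \<Longrightarrow> ind (insert a A) = Poly_Mapping.single a 1 + ind A"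
  by (simp add: ind_def)

lemma keys_expo_add: "Poly_Mapping.keys (a + b) = Poly_Mapping.keys a \<union> Poly_Mapping.keys b" for a b :: expo
  by (auto simp: in_keys_iff lookup_add)

lemma mdeg_superset:
  assumes "finite A" "Poly_Mapping.keys m \<subseteq> A"
  shows "mdeg m = (\<Sum>j\<in>A. Poly_Mapping.lookup m j)"
  unfolding mdeg_def using assms by (intro sum.mono_neutral_left) (auto simp: in_keys_iff)

lemma mdeg_add: "mdeg (a + b) = mdeg a + mdeg b"
proof -
  let ?A = "Poly_Mapping.keys a \<union> Poly_Mapping.keys b"
  have "mdeg c = (\<Sum>j\<in>?A. Poly_Mapping.lookup c j)" if "Poly_Mapping.keys c \<subseteq> ?A" for c
    using that by (intro mdeg_superset) auto
  then show ?thesis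
    by (simp add: keys_expo_add lookup_add sum.distrib)
qed

lemma mdeg_single [simp]: "mdeg (Poly_Mapping.single i k) = k"
  by (simp add: mdeg_def)

lemma mdeg_0 [simp]: "mdeg 0 = 0"
  by (simp add: mdeg_def)

lemma mdeg_ind: "finite A \<Longrightarrow> mdeg (ind A) = card A"
  by (simp add: mdeg_def keys_ind lookup_ind)

lemma lookup_weight_superset:
  assumes "finite A" "Poly_Mapping.keys m \<subseteq> A"
  shows "Poly_Mapping.lookup (weight m) k = (\<Sum>j\<in>A. digit k (Poly_Mapping.lookup m j))"
  unfolding lookup_weight using assms
  by (intro sum.mono_neutral_left) (auto simp: in_keys_iff digit_def)

lemma digit_0: "digit 0 (of_bool b + (a + a)) = of_bool b"
  by (cases b) (simp_all add: digit_def flip: mult_2)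

lemma digit_Suc: "digit (Suc k) (of_bool b + (a + a)) = digit k a"
proof -
  have "(of_bool b + (a + a)) div 2 = a" by (cases b) auto
  then show ?thesis by (simp add: digit_def div_mult2_eq)
qed

lemma
  assumes "finite A"
  shows weight_shift_0: "Poly_Mapping.lookup (weight (ind A + (m + m))) 0 = card A"
    and weight_shift_Suc: "Poly_Mapping.lookup (weight (ind A + (m + m))) (Suc k) = Poly_Mapping.lookup (weight m) k"
proof -
  let ?B = "A \<union> Poly_Mapping.keys m"
  have B: "finite ?B" "Poly_Mapping.keys (ind A + (m + m)) \<subseteq> ?B" "Poly_Mapping.keys m \<subseteq> ?B"
    using assms by (auto simp: keys_expo_add keys_ind)
  show "Poly_Mapping.lookup (weight (ind A + (m + m))) 0 = card A"
    using assms sum.inter_restrict[OF B(1), of "\<lambda>_. 1 :: nat" A]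
    by (simp add: lookup_weight_superset[OF B(1,2)] lookup_add lookup_ind digit_0 of_bool_def Int_absorb1
      flip: of_bool_def)
  show "Poly_Mapping.lookup (weight (ind A + (m + m))) (Suc k) = Poly_Mapping.lookup (weight m) k"
    using assms by (simp add: lookup_weight_superset[OF B(1,2)] lookup_weight_superset[OF B(1,3)]
      lookup_add lookup_ind digit_Suc)
qed

text \<open>Weights compare lexicographically from the lowest row, so a loss there outweighs every
  change in higher rows.\<close>

lemma weight_shift_less:
  assumes "finite A" "finite B"
    and "card A < card B \<or> card A = card B \<and> weight m < weight m'"
  shows "weight (ind A + (m + m)) < weight (ind B + (m' + m'))"
  using assms(3)
proof
  assume "card A < card B"
  then show ?thesis
    using assms unfolding weight_less_iff by (intro exI[of _ 0]) (simp add: weight_shift_0)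
next
  assume *: "card A = card B \<and> weight m < weight m'"
  then obtain k where "Poly_Mapping.lookup (weight m) k < Poly_Mapping.lookup (weight m') k"
    "\<forall>k'<k. Poly_Mapping.lookup (weight m) k' = Poly_Mapping.lookup (weight m') k'"
    unfolding weight_less_iff by blast
  then show ?thesis
    using assms * unfolding weight_less_iff
    by (intro exI[of _ "Suc k"]) (auto simp: weight_shift_Suc weight_shift_0 less_Suc_eq_0_disj)
qed

lemma sum_digits: "a < 2 ^ K \<Longrightarrow> (\<Sum>k<K. 2 ^ k * digit k a) = a"
proof (induction K arbitrary: a)
  case (Suc K)
  have "(\<Sum>k<Suc K. 2 ^ k * digit k a) = a mod 2 + 2 * (\<Sum>k<K. 2 ^ k * digit k (a div 2))"
    by (simp only: sum.lessThan_Suc_shift) (simp add: digit_def sum_distrib_left div_mult2_eq mult.assoc)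
  also have "\<dots> = a"
    using Suc by simp
  finally show ?case .
qed simp

text \<open>Exchange the sums over digits and over variables. Hence the weight determines the
  degree, and equal weights also settle degrees.\<close>

lemma wdeg_weight: "wdeg (weight m) = mdeg m"
proof -
  let ?W = "Poly_Mapping.lookup (weight m)" and ?J = "Poly_Mapping.keys m"
  obtain K0 where K0: "\<And>j. j \<in> ?J \<Longrightarrow> Poly_Mapping.lookup m j \<le> K0"
    using finite_keys by (metis (mono_tags, lifting) finite_imageI finite_nat_set_iff_bounded_le imageI)
  obtain K1 where K1: "\<And>k. k \<in> Poly_Mapping.keys (weight m) \<Longrightarrow> k \<le> K1"
    using finite_keys by (metis finite_nat_set_iff_bounded_le)
  \<comment> \<open>\<open>K\<close> lies above all exponents, hence above the positions of all
    their nonzero digits, and above all indices of nonzero weights; both sums can run over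
    \<open>k < K\<close>.\<close>
  define K where "K = Suc (max K0 K1)"
  have lt: "Poly_Mapping.lookup m j < 2 ^ K" if "j \<in> ?J" for j
  proof -
    have "Poly_Mapping.lookup m j < K"
      using K0[OF that] by (auto simp: K_def)
    also have "K < 2 ^ K" by simp
    finally show ?thesis .
  qed
  have "wdeg (weight m) = (\<Sum>k<K. 2 ^ k * ?W k)"
    unfolding wdeg_def
    by (intro sum.mono_neutral_left) (use K1 in \<open>fastforce simp: K_def in_keys_iff less_Suc_eq_le le_max_iff_disj\<close>)+
  also have "\<dots> = (\<Sum>j\<in>?J. \<Sum>k<K. 2 ^ k * digit k (Poly_Mapping.lookup m j))"
    unfolding lookup_weight sum_distrib_left by (rule sum.swap)
  also have "\<dots> = mdeg m"
    unfolding mdeg_def by (intro sum.cong sum_digits lt) auto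
  finally show ?thesis .
qed

section \<open>Squares and Steenrod operations\<close>

lemma scale2_cases: "scale2 c f = 0 \<or> scale2 c f = f"
  by (cases c) (simp_all add: scale2_def)

text \<open>The only scalars are 0 and 1, so closure under addition suffices.\<close>

lemma subspace_F2I: "0 \<in> S \<Longrightarrow> (\<And>f g. f \<in> S \<Longrightarrow> g \<in> S \<Longrightarrow> f + g \<in> S) \<Longrightarrow> F2.subspace S"
  unfolding F2.subspace_def by (metis scale2_cases)

lemma mpoly2_square_add: "(f + g)\<^sup>2 = f\<^sup>2 + g\<^sup>2" for f g :: mpoly2
proof -
  have "(f + g)\<^sup>2 = f\<^sup>2 + g\<^sup>2 + (f * g + f * g)"
    by (simp only: power2_eq_square algebra_simps)
  then show ?thesis by (simp only: mpoly2_add_self add_0_right)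
qed

lemma mpoly2_add_cancel: "f + (f + g) = g" for f g :: mpoly2
  by (simp flip: add.assoc)

lemma mpoly2_uminus: "- f = f" for f :: mpoly2
  by (metis add.inverse_unique mpoly2_add_self)

lemma mpoly2_diff: "f - g = f + g" for f g :: mpoly2
  by (metis add_uminus_conv_diff mpoly2_uminus)

lemma
  shows Sq_0: "Sq 0 f = f"
    and Sq_1_var: "Sq 1 (var i) = var i ^ 2"
    and Sq_var: "k > 1 \<Longrightarrow> Sq k (var i) = 0"
    and Sq_mult: "Sq k (f * g) = (\<Sum>j\<le>k. Sq j f * Sq (k - j) g)"
    and Sq_1: "k > 0 \<Longrightarrow> Sq k 1 = 0"
  using steenrod_action_Sq steenrod_action_one[OF steenrod_action_Sq]
  by (auto simp only: steenrod_action_def)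

text \<open>Frobenius: for a polynomial \<open>a + t * p\<close> the cross term of the square occurs
  twice and vanishes, so only even powers of \<open>t\<close> survive.\<close>

lemma coeff_square_char2:
  fixes p :: "mpoly2 poly"
  shows "coeff (p * p) k = (if even k then (coeff p (k div 2))\<^sup>2 else 0)"
proof (induction p arbitrary: k)
  case (pCons a p)
  have "smult a (pCons 0 p) + smult a (pCons 0 p) = 0"
    by (intro poly_eqI) (simp only: coeff_add mpoly2_add_self coeff_0)
  moreover have "pCons a p * pCons a p = pCons (a * a) (pCons 0 (p * p)) + (smult a (pCons 0 p) + smult a (pCons 0 p))"
    by (simp add: algebra_simps)
  ultimately have "pCons a p * pCons a p = pCons (a * a) (pCons 0 (p * p))"
    by simp
  then show ?case
    using pCons.IH by (auto simp: coeff_pCons power2_eq_square split: nat.splits elim!: oddE evenE)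
qed simp

text \<open>By the Cartan formula the total square is multiplicative, so these are the coefficients
  of the square of the total square of \<open>f\<close>.\<close>

lemma Sq_square: "Sq k (f\<^sup>2) = (if even k then (Sq (k div 2) f)\<^sup>2 else 0)"
proof -
  have "Sq k (f\<^sup>2) = coeff (total_Sq f * total_Sq f) k"
    by (simp add: power2_eq_square Sq_mult coeff_mult) (simp add: Sq_eq)
  then show ?thesis
    by (simp add: coeff_square_char2) (simp add: Sq_eq)
qed


section \<open>Homogeneous parts of \<open>P n\<close> and degrees of Steenrod operations\<close>

definition hom_P :: "nat \<Rightarrow> nat \<Rightarrow> mpoly2 set" where
  "hom_P n e = P n \<inter> Collect (homogeneous e)"

lemma hom_P_iff: "f \<in> hom_P n e \<longleftrightarrow> (\<forall>m\<in>Poly_Mapping.keys f. Poly_Mapping.keys m \<subseteq> {1..n} \<and> mdeg m = e)"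
  by (auto simp: hom_P_def P_def homogeneous_def)

lemma hom_P_mon: "mon m \<in> hom_P n e \<longleftrightarrow> Poly_Mapping.keys m \<subseteq> {1..n} \<and> mdeg m = e"
  by (simp add: hom_P_iff)

lemma hom_P_0: "0 \<in> hom_P n e"
  by (simp add: hom_P_iff)

lemma hom_P_add: "f \<in> hom_P n e \<Longrightarrow> g \<in> hom_P n e \<Longrightarrow> f + g \<in> hom_P n e"
  using keys_add[of f g] by (fastforce simp: hom_P_iff)

lemma hom_P_sum: "(\<And>a. a \<in> A \<Longrightarrow> f a \<in> hom_P n e) \<Longrightarrow> sum f A \<in> hom_P n e"
  by (induction A rule: infinite_finite_induct) (auto intro: hom_P_0 hom_P_add)

lemma hom_P_mult:
  assumes "f \<in> hom_P n e" "g \<in> hom_P n e'"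
  shows "f * g \<in> hom_P n (e + e')"
proof -
  have "Poly_Mapping.keys (a + b) \<subseteq> {1..n} \<and> mdeg (a + b) = e + e'"
    if "a \<in> Poly_Mapping.keys f" "b \<in> Poly_Mapping.keys g" for a b
    using assms that by (simp add: hom_P_iff keys_expo_add mdeg_add)
  then show ?thesis
    using keys_mult[of f g] unfolding hom_P_iff by blast
qed

lemma Sq_hom_P_mult:
  assumes "\<And>k. Sq k f \<in> hom_P n (e + k)" "\<And>k. Sq k g \<in> hom_P n (e' + k)"
  shows "Sq k (f * g) \<in> hom_P n (e + e' + k)"
  unfolding Sq_mult
proof (rule hom_P_sum)
  fix j assume "j \<in> {..k}"
  then show "Sq j f * Sq (k - j) g \<in> hom_P n (e + e' + k)"
    using hom_P_mult[OF assms(1)[of j] assms(2)[of "k - j"]] by (simp add: algebra_simps)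
qed

lemma Sq_hom_P_var: "i \<in> {1..n} \<Longrightarrow> Sq k (var i) \<in> hom_P n (1 + k)"
  using Sq_0[of "var i"] Sq_1_var[of i] Sq_var[of k i]
  by (cases "k = 0 \<or> k = 1") (auto simp: hom_P_mon hom_P_0 var_power simp flip: One_nat_def, auto simp: var_def hom_P_mon)

lemma Sq_hom_P_1: "Sq k 1 \<in> hom_P n k"
  using Sq_0[of 1] Sq_1[of k] hom_P_mon[of 0 n 0] by (cases "k = 0") (auto simp: hom_P_0)

text \<open>\<open>Sq k\<close> raises degrees by \<open>k\<close>: this holds for 1 and for the
  variables, and passes to products by the Cartan formula.\<close>

lemma Sq_hom_P:
  assumes "Poly_Mapping.keys m \<subseteq> {1..n}"
  shows "Sq k (mon m) \<in> hom_P n (mdeg m + k)"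
proof -
  have pow: "Sq k (var j ^ a) \<in> hom_P n (a + k)" if "j \<in> {1..n}" for a j k
  proof (induction a arbitrary: k)
    case (Suc a)
    show ?case
      using Sq_hom_P_mult[of "var j" n 1 "var j ^ a" a k] Sq_hom_P_var[OF that] Suc by simp
  qed (simp add: Sq_hom_P_1)
  have "Sq k (\<Prod>j\<in>A. var j ^ e j) \<in> hom_P n (sum e A + k)"
    if "finite A" "A \<subseteq> {1..n}" for A and e :: "nat \<Rightarrow> nat"
    using that
  proof (induction A arbitrary: k)
    case (insert a A)
    then show ?case
      using Sq_hom_P_mult[of "var a ^ e a" n "e a" "\<Prod>j\<in>A. var j ^ e j" "sum e A" k] pow by simp
  qed (simp add: Sq_hom_P_1)
  from this[OF _ assms] show ?thesis
    by (simp add: mon_conv_prod mdeg_def)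
qed

section \<open>Steenrod operations on square-free monomials\<close>

lemma Sq_1_mult: "Sq 1 (f * g) = Sq 1 f * g + f * Sq 1 g"
  by (simp add: Sq_mult Sq_0 algebra_simps)

text \<open>\<open>Sq 1\<close> is a derivation that sends each variable to its square.\<close>

lemma Sq_1_mon_ind:
  assumes "finite A"
  shows "Sq 1 (mon (ind A)) = (\<Sum>a\<in>A. mon (ind A + Poly_Mapping.single a 1))"
  using assms
proof (induction A)
  case empty
  then show ?case by (simp add: ind_def Sq_1)
next
  case (insert a A)
  have "Sq 1 (mon (ind (insert a A))) = var a ^ 2 * mon (ind A) + var a * Sq 1 (mon (ind A))"
    by (simp only: ind_insert[OF insert.hyps] mon_add Sq_1_mult Sq_1_var flip: var_def)
  also have "\<dots> = mon (ind (insert a A) + Poly_Mapping.single a 1) + (\<Sum>b\<in>A. mon (ind (insert a A) + Poly_Mapping.single b 1))"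
    using insert by (simp add: ind_insert mon_add var_def power2_eq_square sum_distrib_left mult_ac)
  finally show ?case using insert.hyps by simp
qed

text \<open>Each \<open>a \<in> T\<close> has its variable squared, so \<open>Sq\<^sup>i\<close> moves \<open>i\<close> elements of the lowest row up.\<close>

definition Sq_ind_set :: "nat \<Rightarrow> nat set \<Rightarrow> mpoly2 set" where
  "Sq_ind_set i A = {mon (ind (A - T) + (ind T + ind T)) | T. T \<subseteq> A \<and> card T = i}"

text \<open>Only \<open>Sq 0\<close> and \<open>Sq 1\<close> are nonzero on a variable, so in the
  Cartan formula each new \<open>a\<close> either stays in the lowest row or joins
  \<open>T\<close>.\<close>

lemma Sq_mon_ind:
  assumes "finite A"
  shows "Sq i (mon (ind A)) \<in> F2.span (Sq_ind_set i A)"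
  using assms
proof (induction A arbitrary: i)
  case empty
  have "mon 0 \<in> Sq_ind_set 0 {}"
    by (auto simp: Sq_ind_set_def ind_def)
  then show ?case
    using Sq_0[of 1] Sq_1[of i] by (cases "i = 0") (auto simp: ind_def F2.span_zero intro: F2.span_base)
next
  case (insert a A)
  have fin: "finite T" if "T \<subseteq> A" for T
    using that insert.hyps finite_subset by blast
  have lin: "g * f \<in> F2.span C" if "f \<in> F2.span B" "\<And>h. h \<in> B \<Longrightarrow> g * h \<in> C" for f g B C
    using that(1)
  proof (rule F2.span_induct)
    show "F2.subspace {f. g * f \<in> F2.span C}"
      by (rule subspace_F2I) (auto simp: distrib_left F2.span_zero intro: F2.span_add)
  qed (use that(2) in \<open>auto intro: F2.span_base\<close>)
  \<comment> \<open>Here \<open>Sq 0\<close> acts on \<open>var a\<close>, and \<open>a\<close>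
    stays outside \<open>T\<close>.\<close>
  have 0: "var a * Sq i (mon (ind A)) \<in> F2.span (Sq_ind_set i (insert a A))"
  proof (rule lin[OF insert.IH])
    fix h assume "h \<in> Sq_ind_set i A"
    then obtain T where T: "T \<subseteq> A" "card T = i" "h = mon (ind (A - T) + (ind T + ind T))"
      by (auto simp: Sq_ind_set_def)
    have "insert a A - T = insert a (A - T)" "a \<notin> A - T"
      using T insert.hyps by auto
    then have "var a * h = mon (ind (insert a A - T) + (ind T + ind T))"
      using insert.hyps T by (simp add: ind_insert mon_add var_def mult_ac)
    then show "var a * h \<in> Sq_ind_set i (insert a A)"
      using T by (auto simp: Sq_ind_set_def)
  qed
  \<comment> \<open>Here \<open>Sq 1\<close> acts on \<open>var a\<close>, and \<open>a\<close>
    joins \<open>T\<close>.\<close>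
  have 1: "var a ^ 2 * Sq k (mon (ind A)) \<in> F2.span (Sq_ind_set (Suc k) (insert a A))" for k
  proof (rule lin[OF insert.IH])
    fix h assume "h \<in> Sq_ind_set k A"
    then obtain T where T: "T \<subseteq> A" "card T = k" "h = mon (ind (A - T) + (ind T + ind T))"
      by (auto simp: Sq_ind_set_def)
    then have a: "a \<notin> T" using insert.hyps by auto
    have "insert a A - insert a T = A - T" "card (insert a T) = Suc k"
      using T insert.hyps a fin by auto
    moreover have "var a ^ 2 * h = mon (ind (A - T) + (ind (insert a T) + ind (insert a T)))"
      using a T fin by (simp add: ind_insert mon_add var_def power2_eq_square mult_ac)
    ultimately show "var a ^ 2 * h \<in> Sq_ind_set (Suc k) (insert a A)"
      using T by (auto simp: Sq_ind_set_def intro!: exI[of _ "insert a T"])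
  qed
  have "Sq i (var a * mon (ind A)) \<in> F2.span (Sq_ind_set i (insert a A))"
  proof (cases i)
    case 0
    then show ?thesis using \<open>var a * Sq i (mon (ind A)) \<in> _\<close> by (simp add: Sq_0)
  next
    case (Suc k)
    have "Sq i (var a * mon (ind A)) = (\<Sum>j\<in>{0,1}. Sq j (var a) * Sq (i - j) (mon (ind A)))"
      unfolding Sq_mult using Suc by (intro sum.mono_neutral_right) (auto simp: Sq_var)
    also have "\<dots> = var a * Sq i (mon (ind A)) + var a ^ 2 * Sq k (mon (ind A))"
      using Sq_1_var by (simp add: Suc Sq_0)
    finally show ?thesis
      using 0 1[of k] Suc by (simp add: F2.span_add)
  qed
  then show ?case
    using insert.hyps by (simp add: ind_insert mon_add var_def)
qed

section \<open>Hit polynomials modulo smaller weights\<close>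

definition smaller :: "nat \<Rightarrow> expo \<Rightarrow> mpoly2 set" where
  "smaller n m0 = {mon m | m. Poly_Mapping.keys m \<subseteq> {1..n} \<and> mdeg m = mdeg m0 \<and> weight m < weight m0}"

definition hits :: "nat \<Rightarrow> nat \<Rightarrow> expo \<Rightarrow> mpoly2 set" where
  "hits n s m0 = {Sq j (mon m) | j m. 1 \<le> j \<and> j < 2 ^ s \<and> Poly_Mapping.keys m \<subseteq> {1..n} \<and> mdeg m + j = mdeg m0}"

text \<open>The sum from the definition of the relation, with generators taken in the degree of
  \<open>m0\<close>. Fixing the degree in \<open>hits\<close> gives the error terms of
  \<open>lift_mon_hit\<close> the degree that \<open>smaller\<close> demands.\<close>

definition hit_space :: "nat \<Rightarrow> nat \<Rightarrow> expo \<Rightarrow> mpoly2 set" where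
  "hit_space n s m0 = F2.span (hits n s m0 \<union> smaller n m0)"

lemma smallerI:
  "Poly_Mapping.keys m \<subseteq> {1..n} \<Longrightarrow> mdeg m = mdeg m0 \<Longrightarrow> weight m < weight m0 \<Longrightarrow> mon m \<in> smaller n m0"
  unfolding smaller_def by blast

lemma hitsI:
  "1 \<le> j \<Longrightarrow> j < 2 ^ s \<Longrightarrow> Poly_Mapping.keys m \<subseteq> {1..n} \<Longrightarrow> mdeg m + j = mdeg m0 \<Longrightarrow> Sq j (mon m) \<in> hits n s m0"
  unfolding hits_def by blast

lemma hit_space_0: "0 \<in> hit_space n s m0"
  by (simp add: hit_space_def F2.span_zero)

lemma hit_space_add: "f \<in> hit_space n s m0 \<Longrightarrow> g \<in> hit_space n s m0 \<Longrightarrow> f + g \<in> hit_space n s m0"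
  by (simp add: hit_space_def F2.span_add)

lemma hit_space_sum: "(\<And>a. a \<in> A \<Longrightarrow> f a \<in> hit_space n s m0) \<Longrightarrow> sum f A \<in> hit_space n s m0"
  by (simp add: hit_space_def F2.span_sum)

lemma hit_space_trans:
  assumes "f + g \<in> hit_space n s m0" "g + h \<in> hit_space n s m0"
  shows "f + h \<in> hit_space n s m0"
  using hit_space_add[OF assms] by (simp only: add.assoc mpoly2_add_cancel)

lemma hit_space_mono: "s \<le> s' \<Longrightarrow> hit_space n s m0 \<subseteq> hit_space n s' m0"
proof -
  assume "s \<le> s'"
  then have "j < 2 ^ s'" if "j < 2 ^ s" for j :: nat
    using that by (meson less_le_trans one_le_numeral power_increasing)
  then have "hits n s m0 \<subseteq> hits n s' m0"
    unfolding hits_def by blast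
  then show ?thesis
    unfolding hit_space_def by (intro F2.span_mono Un_mono) auto
qed

text \<open>The degree of \<open>m0\<close> is recovered from its weight, so the space depends on
  the weight alone.\<close>

lemma hit_space_cong: "weight m = weight m' \<Longrightarrow> hit_space n s m = hit_space n s m'"
  by (simp add: hit_space_def hits_def smaller_def flip: wdeg_weight)

lemma smaller_hit_space: "F2.span (smaller n m0) \<subseteq> hit_space n s m0"
  unfolding hit_space_def by (intro F2.span_mono) auto

section \<open>Inserting a lowest row by squaring\<close>

definition lift_mon :: "nat set \<Rightarrow> mpoly2 \<Rightarrow> mpoly2" where
  "lift_mon A f = mon (ind A) * f\<^sup>2"

lemma lift_mon_add: "lift_mon A (f + g) = lift_mon A f + lift_mon A g"
  by (simp add: lift_mon_def mpoly2_square_add distrib_left)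

lemma lift_mon_0: "lift_mon A 0 = 0"
  by (simp add: lift_mon_def)

lemma lift_mon_sum: "lift_mon A (sum f B) = (\<Sum>b\<in>B. lift_mon A (f b))"
  by (induction B rule: infinite_finite_induct) (simp_all add: lift_mon_0 lift_mon_add)

lemma lift_mon_mon: "lift_mon A (mon m) = mon (ind A + (m + m))"
  by (simp add: lift_mon_def mon_add power2_eq_square)

text \<open>As \<open>i > 0\<close>, every \<open>T\<close> is nonempty and the lowest row
  \<open>A - T\<close> is smaller than \<open>A\<close>; the square of \<open>g\<close> affects
  higher rows only.\<close>

lemma Sq_ind_smaller:
  assumes A: "A \<subseteq> {1..n}" and i: "i > 0" and f: "f \<in> F2.span (Sq_ind_set i A)"
    and g: "g \<in> hom_P n e" and deg: "i + 2 * e = 2 * mdeg m0"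
  shows "f * g\<^sup>2 \<in> F2.span (smaller n (ind A + (m0 + m0)))"
  using f
proof (rule F2.span_induct)
  show "F2.subspace {f. f * g\<^sup>2 \<in> F2.span (smaller n (ind A + (m0 + m0)))}"
    by (rule subspace_F2I) (auto simp: distrib_right F2.span_zero intro: F2.span_add)
next
  fix f assume "f \<in> Sq_ind_set i A"
  then obtain T where T: "T \<subseteq> A" "card T = i" "f = mon (ind (A - T) + (ind T + ind T))"
    by (auto simp: Sq_ind_set_def)
  have fin: "finite A" "finite T" "finite (A - T)"
    using A T finite_subset[of _ "{1..n}"] by blast+
  have card: "card (A - T) + i = card A" "card (A - T) < card A"
    using T i fin card_Diff_subset[of T A] card_mono[of A T] by auto
  \<comment> \<open>The square of \<open>mon (ind T)\<close> is absorbed into that of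
    \<open>g\<close>, which leaves a sum of monomials with lowest row \<open>A - T\<close>.\<close>
  have "f * g\<^sup>2 = mon (ind T) ^ 2 * lift_mon (A - T) (\<Sum>m\<in>Poly_Mapping.keys g. mon m)"
    unfolding T(3) lift_mon_def by (subst mpoly2_conv_sum[of g]) (simp add: mon_add power2_eq_square mult_ac)
  also have "\<dots> = (\<Sum>m\<in>Poly_Mapping.keys g. mon (ind (A - T) + ((ind T + m) + (ind T + m))))"
    by (simp add: lift_mon_sum sum_distrib_left lift_mon_mon mon_add power2_eq_square mult_ac)
  also have "\<dots> \<in> F2.span (smaller n (ind A + (m0 + m0)))"
  proof (intro F2.span_sum F2.span_base)
    fix m assume "m \<in> Poly_Mapping.keys g"
    then have m: "Poly_Mapping.keys m \<subseteq> {1..n}" "mdeg m = e"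
      using g by (auto simp: hom_P_iff)
    let ?m = "ind (A - T) + ((ind T + m) + (ind T + m))"
    have "Poly_Mapping.keys ?m \<subseteq> {1..n}"
      using m A T fin by (auto simp: keys_expo_add keys_ind)
    moreover have "mdeg ?m = mdeg (ind A + (m0 + m0))"
      using fin T m deg card by (simp add: mdeg_add mdeg_ind)
    moreover have "weight ?m < weight (ind A + (m0 + m0))"
      using fin card by (intro weight_shift_less) auto
    ultimately show "mon ?m \<in> smaller n (ind A + (m0 + m0))"
      by (rule smallerI)
  qed
  finally show "f * g\<^sup>2 \<in> F2.span (smaller n (ind A + (m0 + m0)))" .
qed

text \<open>Expand \<open>Sq (2 * j)\<close> of the lifted monomial by the Cartan formula. The term
  \<open>i = 0\<close> is the lift of \<open>Sq j (mon m)\<close>; odd \<open>i\<close> leave an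
  operation of odd degree on a square, which is 0; even \<open>i > 0\<close> shrink the lowest row.
  Finally \<open>j < 2 ^ s\<close> gives \<open>2 * j < 2 ^ Suc s\<close>.\<close>

lemma lift_mon_hit:
  assumes A: "A \<subseteq> {1..n}" and f: "f \<in> hit_space n s m0"
  shows "lift_mon A f \<in> hit_space n (Suc s) (ind A + (m0 + m0))"
  using f unfolding hit_space_def[of n s]
proof (rule F2.span_induct)
  show "F2.subspace {f. lift_mon A f \<in> hit_space n (Suc s) (ind A + (m0 + m0))}"
    by (rule subspace_F2I) (auto simp: lift_mon_0 lift_mon_add hit_space_0 hit_space_add)
next
  have fin: "finite A" using A finite_subset by blast
  fix f assume "f \<in> hits n s m0 \<union> smaller n m0"
  then show "lift_mon A f \<in> hit_space n (Suc s) (ind A + (m0 + m0))"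
  proof
    assume "f \<in> smaller n m0"
    then obtain m where "f = mon m" "Poly_Mapping.keys m \<subseteq> {1..n}" "mdeg m = mdeg m0" "weight m < weight m0"
      by (auto simp: smaller_def)
    then have "lift_mon A f \<in> smaller n (ind A + (m0 + m0))"
      unfolding \<open>f = _\<close> lift_mon_mon using A fin
      by (intro smallerI weight_shift_less) (simp_all add: keys_expo_add keys_ind mdeg_add)
    then show ?thesis by (simp add: hit_space_def F2.span_base)
  next
    assume "f \<in> hits n s m0"
    then obtain j m where j: "1 \<le> j" "j < 2 ^ s" and f: "f = Sq j (mon m)"
      and m: "Poly_Mapping.keys m \<subseteq> {1..n}" "mdeg m + j = mdeg m0"
      by (auto simp: hits_def)
    let ?g = "\<lambda>i. Sq i (mon (ind A)) * Sq (2 * j - i) ((mon m)\<^sup>2)"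
    let ?H = "hit_space n (Suc s) (ind A + (m0 + m0))"
    have "Sq (2 * j) (mon (ind A + (m + m))) = (\<Sum>i\<le>2 * j. ?g i)"
      by (simp add: mon_add Sq_mult power2_eq_square)
    also have "\<dots> = ?g 0 + (\<Sum>i\<in>{..2 * j} - {0}. ?g i)"
      by (subst sum.remove[of _ 0]) auto
    also have "?g 0 = lift_mon A f"
      by (simp add: Sq_0 Sq_square lift_mon_def f)
    finally have eq: "lift_mon A f = Sq (2 * j) (mon (ind A + (m + m))) + (\<Sum>i\<in>{..2 * j} - {0}. ?g i)"
      by (simp only: add.assoc mpoly2_add_self add_0_right)
    have "Sq (2 * j) (mon (ind A + (m + m))) \<in> hits n (Suc s) (ind A + (m0 + m0))"
      using j m A fin by (intro hitsI) (auto simp: keys_expo_add keys_ind mdeg_add)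
    then have "Sq (2 * j) (mon (ind A + (m + m))) \<in> ?H"
      by (simp add: hit_space_def F2.span_base)
    moreover have "?g i \<in> ?H" if i: "i \<in> {..2 * j} - {0}" for i
    proof (cases "even i")
      case True
      then obtain k where k: "i = 2 * k" by (auto elim: evenE)
      have "Sq (2 * j - i) ((mon m)\<^sup>2) = (Sq (j - k) (mon m))\<^sup>2"
        by (simp add: Sq_square k flip: diff_mult_distrib2)
      moreover have "Sq i (mon (ind A)) * (Sq (j - k) (mon m))\<^sup>2 \<in> F2.span (smaller n (ind A + (m0 + m0)))"
        using i k m by (intro Sq_ind_smaller[OF A _ Sq_mon_ind[OF fin] Sq_hom_P[OF m(1)]]) auto
      ultimately show ?thesis
        using smaller_hit_space by auto
    next
      case False
      then have "odd (2 * j - i)" using i by auto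
      then show ?thesis by (simp add: Sq_square hit_space_0)
    qed
    ultimately show ?thesis
      unfolding eq by (intro hit_space_add hit_space_sum)
  qed
qed

text \<open>Each inserted row doubles the index of the operation, so \<open>s\<close> rises by the
  number of rows.\<close>

lemma lift_mons_hit:
  assumes "As \<in> lists (Pow {1..n})" "f \<in> hit_space n s m0"
  shows "foldr lift_mon As f \<in> hit_space n (s + length As) (foldr (\<lambda>A m. ind A + (m + m)) As m0)"
  using assms by (induction As) (auto intro: lift_mon_hit simp del: One_nat_def)


section \<open>Relations between monomials given by dyadic digits\<close>

text \<open>The head of the list is the lowest row; the recursion is Horner's scheme in base
  2.\<close>

fun dyad :: "nat set list \<Rightarrow> expo" where
  "dyad [] = 0"
| "dyad (A # As) = ind A + (dyad As + dyad As)"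

lemma keys_dyad: "As \<in> lists (Pow {1..n}) \<Longrightarrow> Poly_Mapping.keys (dyad As) \<subseteq> {1..n}"
proof (induction As)
  case (Cons A As)
  then have "finite A" using finite_subset by auto
  with Cons show ?case by (auto simp: keys_expo_add keys_ind)
qed simp

lemma weight_eqI:
  assumes "finite A" "finite B" "card A = card B" "weight m = weight m'"
  shows "weight (ind A + (m + m)) = weight (ind B + (m' + m'))"
proof (rule poly_mapping_eqI)
  fix k show "Poly_Mapping.lookup (weight (ind A + (m + m))) k = Poly_Mapping.lookup (weight (ind B + (m' + m'))) k"
    using assms by (cases k) (simp_all add: weight_shift_0 weight_shift_Suc)
qed

text \<open>The entries of the weight are the sizes of the rows.\<close>

lemma weight_dyad_cong:
  assumes "As \<in> lists (Pow {1..n})" "Bs \<in> lists (Pow {1..n})" "map card As = map card Bs"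
  shows "weight (dyad As) = weight (dyad Bs)"
  using assms(3,1,2)
proof (induction As Bs rule: list_induct2'[consumes 0])
  case (4 A As B Bs)
  then have "finite A" "finite B" using finite_subset[of _ "{1..n}"] by auto
  with 4 show ?case by (auto intro: weight_eqI)
qed auto

lemma foldr_lift_mon_add: "foldr lift_mon As (f + g) = foldr lift_mon As f + foldr lift_mon As g"
  by (induction As) (simp_all add: lift_mon_add)

lemma foldr_lift_mon_sum: "foldr lift_mon As (sum f B) = (\<Sum>b\<in>B. foldr lift_mon As (f b))"
  by (induction As) (simp_all add: lift_mon_sum)

lemma foldr_lift_mon_dyad: "foldr lift_mon As (mon (dyad Bs)) = mon (dyad (As @ Bs))"
  by (induction As) (simp_all add: lift_mon_mon)

lemma foldr_dyad: "foldr (\<lambda>A m. ind A + (m + m)) As (dyad Bs) = dyad (As @ Bs)"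
  by (induction As) simp_all

text \<open>The lowest digit at \<open>j\<close> is 1, so adding 1 clears it and carries into
  \<open>m\<close>.\<close>

lemma ind_carry: "finite A \<Longrightarrow> j \<in> A \<Longrightarrow>
    ind A + (m + m) + Poly_Mapping.single j 1 =
    ind (A - {j}) + ((m + Poly_Mapping.single j 1) + (m + Poly_Mapping.single j 1))"
  using ind_insert[of "A - {j}" j] by (simp add: insert_absorb ac_simps)

lemma dyad_insert: "finite A \<Longrightarrow> j \<notin> A \<Longrightarrow>
    dyad (A # As) + Poly_Mapping.single j 1 = dyad (insert j A # As)"
  by (simp add: ind_insert ac_simps)

text \<open>The carry runs through the \<open>k\<close> full rows, removes \<open>j\<close> from
  each, and then acts on the rows behind them.\<close>

lemma dyad_carry:
  assumes "j \<in> {1..n}" "dyad As + Poly_Mapping.single j 1 = dyad Bs"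
  shows "dyad (replicate k {1..n} @ As) + Poly_Mapping.single j 1 = dyad (replicate k ({1..n} - {j}) @ Bs)"
  using assms by (induction k) (simp_all add: ind_carry del: One_nat_def)

text \<open>The derivation \<open>Sq 1\<close> kills the square that holds the higher rows, so it
  acts on the lowest row only, which is full because \<open>k > 0\<close>.\<close>

lemma Sq_1_dyad:
  assumes "k > 0"
  shows "Sq 1 (mon (dyad (replicate k {1..n} @ As))) =
    (\<Sum>j\<in>{1..n}. mon (dyad (replicate k {1..n} @ As) + Poly_Mapping.single j 1))"
proof -
  obtain l where k: "k = Suc l" using assms by (cases k) auto
  let ?f = "mon (dyad (replicate l {1..n} @ As))"
  have "Sq 1 (?f\<^sup>2) = 0"
    by (simp only: Sq_square) simp
  moreover have "mon (dyad (replicate k {1..n} @ As)) = mon (ind {1..n}) * ?f\<^sup>2"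
    using lift_mon_mon[of "{1..n}"] by (simp add: k lift_mon_def)
  ultimately have "Sq 1 (mon (dyad (replicate k {1..n} @ As))) = Sq 1 (mon (ind {1..n})) * ?f\<^sup>2"
    by (simp only: Sq_1_mult) simp
  also have "\<dots> = (\<Sum>j\<in>{1..n}. mon (dyad (replicate k {1..n} @ As) + Poly_Mapping.single j 1))"
    unfolding Sq_1_mon_ind[OF finite_atLeastAtMost] sum_distrib_right
    by (simp add: k mon_add power2_eq_square mult_ac)
  finally show ?thesis .
qed

text \<open>\<open>Sq 1\<close> is applied to \<open>k\<close> full rows with nothing above them:
  each carry ends in a new row \<open>{j}\<close>. The index \<open>c\<close> selects one of these
  monomials of equal degree as reference.\<close>

lemma all_ones_base:
  assumes "k > 0" "c \<in> {1..n}"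
  shows "(\<Sum>j\<in>{1..n}. mon (dyad (replicate k ({1..n} - {j}) @ [{j}])))
    \<in> hit_space n 1 (dyad (replicate k ({1..n} - {c}) @ [{c}]))"
proof -
  let ?m = "dyad (replicate k {1..n} @ [])"
  have eq: "?m + Poly_Mapping.single j 1 = dyad (replicate k ({1..n} - {j}) @ [{j}])" if "j \<in> {1..n}" for j
    using that by (intro dyad_carry) (simp_all add: ind_singleton)
  have keys: "Poly_Mapping.keys ?m \<subseteq> {1..n}"
    by (rule keys_dyad) auto
  have "Sq 1 (mon ?m) \<in> hits n 1 (dyad (replicate k ({1..n} - {c}) @ [{c}]))"
    unfolding eq[OF assms(2), symmetric] by (intro hitsI keys) (simp_all add: mdeg_add)
  then have "Sq 1 (mon ?m) \<in> hit_space n 1 (dyad (replicate k ({1..n} - {c}) @ [{c}]))"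
    by (simp only: hit_space_def) (intro F2.span_base UnI1)
  also have "Sq 1 (mon ?m) = (\<Sum>j\<in>{1..n}. mon (dyad (replicate k ({1..n} - {j}) @ [{j}])))"
    unfolding Sq_1_dyad[OF assms(1)] by (intro sum.cong refl) (simp only: eq)
  finally show ?thesis .
qed

text \<open>\<open>Sq 1\<close> is applied to \<open>k\<close> full rows followed by a row lacking
  \<open>a\<close> and \<open>b\<close>. The carries of \<open>a\<close> and \<open>b\<close> fill
  one gap each and give the two monomials; every other carry removes a further element from that
  row, so the weight drops.\<close>

lemma swap_base:
  assumes k: "k > 0" and ab: "a \<in> {1..n}" "b \<in> {1..n}" "a \<noteq> b" and As: "As \<in> lists (Pow {1..n})"
  shows "mon (dyad (replicate k ({1..n} - {a}) @ ({1..n} - {b}) # As))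
      + mon (dyad (replicate k ({1..n} - {b}) @ ({1..n} - {a}) # As))
    \<in> hit_space n 1 (dyad (replicate k ({1..n} - {a}) @ ({1..n} - {b}) # As))"
proof -
  let ?N = "{1..n}"
  let ?X = "?N - {a, b}"
  let ?m = "dyad (replicate k ?N @ ?X # As)"
  let ?w = "dyad (replicate k (?N - {a}) @ (?N - {b}) # As)"
  have a: "?m + Poly_Mapping.single a 1 = dyad (replicate k (?N - {a}) @ (?N - {b}) # As)"
  proof (rule dyad_carry[OF ab(1)])
    have "insert a ?X = ?N - {b}" using ab by auto
    then show "dyad (?X # As) + Poly_Mapping.single a 1 = dyad ((?N - {b}) # As)"
      using dyad_insert[of ?X a As] by simp
  qed
  have b: "?m + Poly_Mapping.single b 1 = dyad (replicate k (?N - {b}) @ (?N - {a}) # As)"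
  proof (rule dyad_carry[OF ab(2)])
    have "insert b ?X = ?N - {a}" using ab by auto
    then show "dyad (?X # As) + Poly_Mapping.single b 1 = dyad ((?N - {a}) # As)"
      using dyad_insert[of ?X b As] by simp
  qed
  have keys: "Poly_Mapping.keys ?m \<subseteq> ?N"
    using As by (intro keys_dyad) auto
  have deg: "mdeg ?m + 1 = mdeg ?w"
    unfolding a[symmetric] mdeg_add by simp
  have "Sq 1 (mon ?m) \<in> hits n 1 ?w"
    by (intro hitsI keys deg) simp_all
  then have hit: "Sq 1 (mon ?m) \<in> hit_space n 1 ?w"
    by (simp only: hit_space_def) (intro F2.span_base UnI1)
  \<comment> \<open>The first \<open>l\<close> rows have \<open>n - 1\<close> elements on both
    sides, so the next row decides; it lacks \<open>j\<close> as well as \<open>a\<close> and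
    \<open>b\<close>.\<close>
  have less: "weight (dyad (replicate l ?N @ ?X # As) + Poly_Mapping.single j 1)
      < weight (dyad (replicate l (?N - {a}) @ (?N - {b}) # As))" if j: "j \<in> ?X" for j l
  proof (induction l)
    case 0
    have "card (?X - {j}) < card (?N - {b})"
      using j by (intro psubset_card_mono psubsetI) blast+
    then show ?case
      using j by (simp add: ind_carry weight_shift_less del: One_nat_def)
  next
    case (Suc l)
    moreover have "card (?N - {j}) = card (?N - {a})"
      using j ab by (simp add: card_Diff_singleton)
    ultimately show ?case
      using j by (simp add: ind_carry weight_shift_less del: One_nat_def)
  qed
  have low: "mon (?m + Poly_Mapping.single j 1) \<in> hit_space n 1 ?w" if j: "j \<in> ?X" for j
  proof -
    have "mon (?m + Poly_Mapping.single j 1) \<in> smaller n ?w"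
      using keys deg less[OF j, of k] j by (intro smallerI) (auto simp: keys_expo_add mdeg_add)
    then show ?thesis
      by (simp only: hit_space_def) (intro F2.span_base UnI2)
  qed
  have "Sq 1 (mon ?m) = mon (?m + Poly_Mapping.single a 1) + (mon (?m + Poly_Mapping.single b 1)
     + (\<Sum>j\<in>?X. mon (?m + Poly_Mapping.single j 1)))"
  proof -
    have "?N - {a} - {b} = ?X" by auto
    then have "sum g ?N = g a + (g b + sum g ?X)" for g :: "nat \<Rightarrow> mpoly2"
      using sum.remove[OF finite_atLeastAtMost ab(1), of g] sum.remove[of "?N - {a}" b g] ab by simp
    then show ?thesis
      unfolding Sq_1_dyad[OF k] .
  qed
  then have "mon (?m + Poly_Mapping.single a 1) + mon (?m + Poly_Mapping.single b 1)
      = Sq 1 (mon ?m) + (\<Sum>j\<in>?X. mon (?m + Poly_Mapping.single j 1))"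
    by (simp only: add.assoc mpoly2_add_self add_0_right)
  also have "\<dots> \<in> hit_space n 1 ?w"
    by (intro hit_space_add hit hit_space_sum low)
  finally show ?thesis unfolding a b .
qed

section \<open>Sequences of missing variables\<close>

text \<open>The entries of \<open>cs\<close> are the variables missing from the rows.\<close>

definition mon_seq :: "nat \<Rightarrow> nat list \<Rightarrow> nat \<Rightarrow> mpoly2" where
  "mon_seq n cs e = mon (dyad (map (\<lambda>c. {1..n} - {c}) cs @ [{e}]))"

text \<open>The reference monomial is the left-hand side of the claim; by
  \<open>seq_space_eq\<close> other sequences of the same length give the same space.\<close>

definition seq_space :: "nat \<Rightarrow> nat \<Rightarrow> mpoly2 set" where
  "seq_space n d = hit_space n n (dyad (map (\<lambda>c. {1..n} - {c}) (replicate d n) @ [{n}]))"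

lemma rows_in_lists: "e \<in> {1..n} \<Longrightarrow> map (\<lambda>c. {1..n} - {c}) cs @ [{e}] \<in> lists (Pow {1..n})"
  by auto

text \<open>Every row but the last has \<open>n - 1\<close> elements and the last has one, whatever
  the sequence.\<close>

lemma weight_seq:
  assumes "e \<in> {1..n}" "e' \<in> {1..n}" "set cs \<subseteq> {1..n}" "set cs' \<subseteq> {1..n}" "length cs = length cs'"
  shows "weight (dyad (map (\<lambda>c. {1..n} - {c}) cs @ [{e}])) = weight (dyad (map (\<lambda>c. {1..n} - {c}) cs' @ [{e'}]))"
proof (rule weight_dyad_cong[OF rows_in_lists rows_in_lists])
  have "map (card \<circ> (\<lambda>c. {1..n} - {c})) xs = replicate (length xs) (n - 1)" if "set xs \<subseteq> {1..n}" for xs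
    using that by (induction xs) (auto simp: card_Diff_singleton)
  then show "map card (map (\<lambda>c. {1..n} - {c}) cs @ [{e}]) = map card (map (\<lambda>c. {1..n} - {c}) cs' @ [{e'}])"
    using assms by simp
qed (use assms in auto)

lemma seq_space_eq:
  assumes "e \<in> {1..n}" "set cs \<subseteq> {1..n}" "length cs = d"
  shows "seq_space n d = hit_space n n (dyad (map (\<lambda>c. {1..n} - {c}) cs @ [{e}]))"
  unfolding seq_space_def using assms by (intro hit_space_cong weight_seq) auto

text \<open>This is \<open>all_ones_base\<close> behind the rows of \<open>p\<close>. With
  \<open>length p < n\<close> the operations stay below \<open>2 ^ n\<close>, and
  \<open>length p < d\<close> leaves a nonempty block.\<close>

lemma seq_space_sum_last:
  assumes "set p \<subseteq> {1..n}" "length p < n" "length p < d"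
  shows "(\<Sum>j\<in>{1..n}. mon_seq n (p @ replicate (d - length p) j) j) \<in> seq_space n d"
proof -
  let ?r = "\<lambda>c. {1..n} - {c}"
  have n: "n \<in> {1..n}" using assms by auto
  have "foldr lift_mon (map ?r p) (\<Sum>j\<in>{1..n}. mon (dyad (replicate (d - length p) (?r j) @ [{j}])))
     \<in> hit_space n (1 + length (map ?r p)) (foldr (\<lambda>A m. ind A + (m + m)) (map ?r p)
          (dyad (replicate (d - length p) (?r n) @ [{n}])))"
    using assms n by (intro lift_mons_hit all_ones_base) auto
  then have "(\<Sum>j\<in>{1..n}. mon_seq n (p @ replicate (d - length p) j) j) \<in>
     hit_space n (1 + length p) (dyad (map ?r (p @ replicate (d - length p) n) @ [{n}]))"
    by (simp add: foldr_lift_mon_sum foldr_lift_mon_dyad foldr_dyad mon_seq_def)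
  also have "\<dots> \<subseteq> seq_space n d"
    using assms n by (subst seq_space_eq[of n n "p @ replicate (d - length p) n"]) (auto intro!: hit_space_mono)
  finally show ?thesis .
qed

section \<open>Rearranging sequences modulo hits\<close>

definition seq_equiv :: "nat \<Rightarrow> nat \<Rightarrow> nat list \<Rightarrow> nat list \<Rightarrow> bool" where
  "seq_equiv n e cs cs' \<longleftrightarrow> length cs = length cs' \<and> mon_seq n cs e + mon_seq n cs' e \<in> seq_space n (length cs)"

lemma seq_equiv_refl: "seq_equiv n e cs cs"
  by (simp add: seq_equiv_def seq_space_def hit_space_0)

lemma seq_equiv_sym: "seq_equiv n e cs cs' \<Longrightarrow> seq_equiv n e cs' cs"
  by (auto simp: seq_equiv_def add.commute)

lemma seq_equiv_trans [trans]:
  "seq_equiv n e cs cs' \<Longrightarrow> seq_equiv n e cs' cs'' \<Longrightarrow> seq_equiv n e cs cs''"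
  by (auto simp: seq_equiv_def seq_space_def intro: hit_space_trans)

text \<open>\<open>swap_base\<close> has \<open>s = 1\<close>, and the prefix raises this to
  \<open>1 + length p\<close>, which is at most \<open>n\<close>.\<close>

lemma seq_equiv_swap:
  assumes "set p \<subseteq> {1..n}" "set q \<subseteq> {1..n}" "a \<in> {1..n}" "b \<in> {1..n}" "e \<in> {1..n}"
    and "k > 0" "length p < n"
  shows "seq_equiv n e (p @ replicate k a @ b # q) (p @ replicate k b @ a # q)"
proof (cases "a = b")
  case False
  let ?r = "\<lambda>c. {1..n} - {c}"
  let ?A = "\<lambda>a b. replicate k (?r a) @ ?r b # map ?r q @ [{e}]"
  have "foldr lift_mon (map ?r p) (mon (dyad (?A a b)) + mon (dyad (?A b a)))
     \<in> hit_space n (1 + length (map ?r p)) (foldr (\<lambda>A m. ind A + (m + m)) (map ?r p) (dyad (?A a b)))"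
    using assms False by (intro lift_mons_hit swap_base) auto
  then have "mon_seq n (p @ replicate k a @ b # q) e + mon_seq n (p @ replicate k b @ a # q) e
     \<in> hit_space n (1 + length p) (dyad (map ?r (p @ replicate k a @ b # q) @ [{e}]))"
    by (simp add: foldr_lift_mon_add foldr_lift_mon_dyad foldr_dyad mon_seq_def)
  also have "\<dots> \<subseteq> seq_space n (length (p @ replicate k a @ b # q))"
    using assms by (subst seq_space_eq[of e n "p @ replicate k a @ b # q"]) (auto intro!: hit_space_mono)
  finally show ?thesis by (simp add: seq_equiv_def)
qed (simp add: seq_equiv_refl)

text \<open>Adjacent transpositions, which are swaps with \<open>k = 1\<close>. Their prefixes have
  at most \<open>length p + length q - 1\<close> entries, fewer than \<open>n\<close>.\<close>

lemma seq_equiv_move: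
  assumes "set p \<subseteq> {1..n}" "set q \<subseteq> {1..n}" "set t \<subseteq> {1..n}" "a \<in> {1..n}" "e \<in> {1..n}"
    and "length p + length q \<le> n"
  shows "seq_equiv n e (p @ a # q @ t) (p @ q @ a # t)"
  using assms
proof (induction q arbitrary: p)
  case (Cons b q)
  have "seq_equiv n e (p @ a # b # q @ t) (p @ b # a # q @ t)"
    using seq_equiv_swap[of p n "q @ t" a b e 1] Cons.prems by simp
  also have "seq_equiv n e (p @ b # a # q @ t) (p @ b # q @ a # t)"
    using Cons.IH[of "p @ [b]"] Cons.prems by simp
  finally show ?case by simp
qed (simp add: seq_equiv_refl)

text \<open>\<open>seq_equiv_swap\<close> treats a block followed by a single entry; here the single
  entry comes first. The bound on \<open>p\<close> leaves room for swaps behind one more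
  entry.\<close>

lemma seq_equiv_flip:
  assumes "set p \<subseteq> {1..n}" "set q \<subseteq> {1..n}" "a \<in> {1..n}" "b \<in> {1..n}" "e \<in> {1..n}"
    and "l > 0" "Suc (length p) < n"
  shows "seq_equiv n e (p @ a # replicate l b @ q) (p @ b # replicate l a @ q)"
  using \<open>l > 0\<close> assms(2,3,4)
proof (induction l arbitrary: a b q rule: nat_induct_non_zero)
  case 1
  then show ?case
    using seq_equiv_swap[of p n q a b e 1] assms by simp
next
  case (Suc l)
  have app: "replicate l x @ x # ys = replicate (Suc l) x @ ys" for x and ys :: "nat list"
    by (simp add: replicate_app_Cons_same)
  \<comment> \<open>Without \<open>p\<close> and \<open>q\<close> the chain is
    \<open>a b^l b\<close>, \<open>b a^l b\<close>, \<open>b b^l a\<close>, \<open>a a^l b\<close>,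
    \<open>a b^l a\<close>, \<open>b a^l a\<close>. The first and last steps use the induction
    hypothesis, the others swap a block with the entry behind it.\<close>
  have "seq_equiv n e (p @ a # replicate l b @ b # q) (p @ b # replicate l a @ b # q)"
    using Suc.IH[of "b # q" a b] Suc.prems by simp
  also have "seq_equiv n e (p @ b # replicate l a @ b # q) (p @ b # replicate l b @ a # q)"
    using seq_equiv_swap[of "p @ [b]" n q a b e l] Suc assms by simp
  also have "seq_equiv n e (p @ b # replicate l b @ a # q) (p @ a # replicate l a @ b # q)"
    using seq_equiv_swap[of p n q b a e "Suc l"] Suc assms by simp
  also have "seq_equiv n e (p @ a # replicate l a @ b # q) (p @ a # replicate l b @ a # q)"
    using seq_equiv_swap[of "p @ [a]" n q a b e l] Suc assms by simp
  also have "seq_equiv n e (p @ a # replicate l b @ a # q) (p @ b # replicate l a @ a # q)"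
    using Suc.IH[of "a # q" a b] Suc.prems by simp
  finally show ?case
    by (simp add: app)
qed


section \<open>Summation over decreasing sequences\<close>

lemma seq_space_add: "f \<in> seq_space n d \<Longrightarrow> g \<in> seq_space n d \<Longrightarrow> f + g \<in> seq_space n d"
  by (simp add: seq_space_def hit_space_add)

lemma seq_space_sum: "(\<And>a. a \<in> A \<Longrightarrow> f a \<in> seq_space n d) \<Longrightarrow> sum f A \<in> seq_space n d"
  by (simp add: seq_space_def hit_space_sum)

lemma seq_space_cancel: "f + g \<in> seq_space n d \<Longrightarrow> f \<in> seq_space n d \<Longrightarrow> g \<in> seq_space n d"
  using seq_space_add[of f n d "f + g"] by (simp only: mpoly2_add_cancel)

definition decr :: "nat set \<Rightarrow> nat list" where
  "decr C = rev (sorted_list_of_set C)"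

text \<open>The \<open>j\<close>-th term of the relation \<open>seq_space_sum_last\<close> for the
  prefix \<open>decr C\<close>.\<close>

definition padded :: "nat \<Rightarrow> nat \<Rightarrow> nat \<Rightarrow> nat set \<Rightarrow> mpoly2" where
  "padded n d j C = mon_seq n (decr C @ replicate (d - card C) j) j"

text \<open>The two sequences differ in the place of one \<open>j\<close>: inside the prefix for
  \<open>insert j C\<close>, at the start of the padding for \<open>C\<close>.
  \<open>seq_equiv_move\<close> carries it past the smaller entries \<open>q\<close>.\<close>

lemma padded_insert:
  assumes d: "n \<le> d" and j: "j \<in> {1..n-1}" and C: "C \<subseteq> {1..n-1} - {j}"
  shows "padded n d j C + padded n d j (insert j C) \<in> seq_space n d"
proof -
  have finC: "finite C" and jC: "j \<notin> C"
    using C finite_subset[of C "{1..n-1}"] by auto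
  have "j \<in> set (decr (insert j C))"
    unfolding decr_def set_rev using finC by (subst set_sorted_list_of_set) auto
  then obtain p q where pq: "decr (insert j C) = p @ j # q"
    by (meson split_list)
  then have l: "sorted_list_of_set (insert j C) = rev q @ j # rev p"
    by (simp add: decr_def rev_swap)
  have "distinct (rev q @ j # rev p)"
    unfolding l[symmetric] by simp
  moreover have "sorted_list_of_set C = remove1 j (sorted_list_of_set (insert j C))"
    using sorted_list_of_set_remove[of "insert j C" j] finC jC by simp
  ultimately have "sorted_list_of_set C = rev q @ rev p"
    unfolding l by (simp add: remove1_append)
  then have C_eq: "decr C = p @ q"
    by (simp add: decr_def)
  have set: "set p \<union> set q = C" and len: "length p + length q = card C"
    using finC arg_cong[OF C_eq, of set] arg_cong[OF C_eq, of length] by (auto simp: decr_def)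
  have "card C \<le> card ({1..n-1} - {j})"
    using C by (intro card_mono) auto
  then have card: "card C < n" "card C < d"
    using j d by auto
  \<comment> \<open>Since \<open>card C < d\<close>, the padding of \<open>C\<close> contains at
    least one \<open>j\<close> that can be split off.\<close>
  have rep: "j # replicate (d - Suc (card C)) j = replicate (d - card C) j"
    using card by (metis Suc_diff_Suc replicate_Suc)
  have "set p \<subseteq> {1..n}" "set q \<subseteq> {1..n}"
    using set C by fastforce+
  then have "seq_equiv n j (p @ j # q @ replicate (d - Suc (card C)) j) (p @ q @ j # replicate (d - Suc (card C)) j)"
    using len card j by (intro seq_equiv_move) auto
  moreover have "length (p @ j # q @ replicate (d - Suc (card C)) j) = d"
    using len card by simp
  ultimately show ?thesis
    using finC jC by (simp add: seq_equiv_def padded_def C_eq pq rep add.commute del: length_append)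
qed

text \<open>Pair each \<open>C\<close> that avoids \<open>j\<close> with
  \<open>insert j C\<close>.\<close>

lemma sum_padded_Pow:
  assumes d: "n \<le> d" and j: "j \<in> {1..n-1}"
  shows "(\<Sum>C\<in>Pow {1..n-1}. padded n d j C) \<in> seq_space n d"
proof -
  let ?M = "{1..n-1} - {j}"
  have Pow: "Pow {1..n-1} = Pow ?M \<union> insert j ` Pow ?M"
    using j Pow_insert[of j ?M] by (simp add: insert_absorb)
  have "inj_on (insert j) (Pow ?M)"
    by (intro inj_onI) blast
  then have "(\<Sum>C\<in>Pow {1..n-1}. padded n d j C) = (\<Sum>C\<in>Pow ?M. padded n d j C + padded n d j (insert j C))"
    unfolding Pow by (subst sum.union_disjoint) (auto simp: sum.reindex sum.distrib)
  also have "\<dots> \<in> seq_space n d"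
    using d j by (intro seq_space_sum padded_insert) auto
  finally show ?thesis .
qed

text \<open>Sum the relation over all prefixes and exchange the sums; the parts with
  \<open>j < n\<close> lie in the space by the pairing, hence so does the part with
  \<open>j = n\<close>.\<close>

lemma sum_padded_last:
  assumes n: "n > 0" and d: "n \<le> d"
  shows "(\<Sum>C\<in>Pow {1..n-1}. padded n d n C) \<in> seq_space n d"
proof -
  let ?M = "{1..n-1}"
  have "(\<Sum>C\<in>Pow ?M. \<Sum>j\<in>{1..n}. padded n d j C) \<in> seq_space n d"
  proof (rule seq_space_sum)
    fix C assume "C \<in> Pow ?M"
    then have C: "C \<subseteq> ?M" by simp
    have "C \<subseteq> {1..n}" "finite C" "card C \<le> card ?M"
      using C by fastforce (use C finite_subset card_mono in blast)+
    then show "(\<Sum>j\<in>{1..n}. padded n d j C) \<in> seq_space n d"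
      using seq_space_sum_last[of "decr C" n d] n d by (simp add: padded_def decr_def)
  qed
  also have "(\<Sum>C\<in>Pow ?M. \<Sum>j\<in>{1..n}. padded n d j C) = (\<Sum>j\<in>{1..n}. \<Sum>C\<in>Pow ?M. padded n d j C)"
    by (rule sum.swap)
  also have "{1..n} = insert n ?M"
    using n by auto
  also have "(\<Sum>j\<in>insert n ?M. \<Sum>C\<in>Pow ?M. padded n d j C)
    = (\<Sum>j\<in>?M. \<Sum>C\<in>Pow ?M. padded n d j C) + (\<Sum>C\<in>Pow ?M. padded n d n C)"
    using n by (simp add: add.commute)
  finally have "(\<Sum>j\<in>?M. \<Sum>C\<in>Pow ?M. padded n d j C) + (\<Sum>C\<in>Pow ?M. padded n d n C) \<in> seq_space n d" .
  moreover have "(\<Sum>j\<in>?M. \<Sum>C\<in>Pow ?M. padded n d j C) \<in> seq_space n d"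
    by (rule seq_space_sum) (rule sum_padded_Pow[OF d])
  ultimately show ?thesis
    by (rule seq_space_cancel)
qed

text \<open>A nonempty \<open>C\<close> corresponds to its least element \<open>i\<close> and the
  increasing list \<open>I\<close> of the others.\<close>

lemma sum_padded_N_set:
  "(\<Sum>C\<in>Pow {1..m} - {{}}. padded n d e C) =
   (\<Sum>(i, I)\<in>N_set m. mon_seq n (rev I @ i # replicate (d - Suc (length I)) e) e)"
proof (rule sum.reindex_bij_witness[where j = "\<lambda>C. (hd (sorted_list_of_set C), tl (sorted_list_of_set C))"
        and i = "\<lambda>(i, I). set (i # I)"])
  fix C assume C: "C \<in> Pow {1..m} - {{}}"
  then have fin: "finite C" using finite_subset by auto
  let ?l = "sorted_list_of_set C"
  have l: "hd ?l # tl ?l = ?l"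
    using C fin by (simp add: hd_Cons_tl)
  then show "(case (hd ?l, tl ?l) of (i, I) \<Rightarrow> set (i # I)) = C"
    using fin by (simp only: prod.case set_sorted_list_of_set)
  have "card C \<le> card {1..m}"
    using C by (intro card_mono) auto
  then have "length ?l \<le> m" by simp
  then have len: "length (tl ?l) < m"
    using arg_cong[OF l, of length] by simp
  have "hd ?l \<in> C"
    using arg_cong[OF l, of set] fin by auto
  then have "1 \<le> hd ?l"
    using C by auto
  moreover have "sorted_wrt (<) (hd ?l # tl ?l)" "\<forall>j\<in>set (hd ?l # tl ?l). j \<le> m"
    unfolding l using C fin by auto
  ultimately show "(hd ?l, tl ?l) \<in> N_set m"
    using len unfolding N_set_def by blast
  have l': "rev (tl ?l) @ [hd ?l] = decr C"
    unfolding decr_def by (subst (3) l[symmetric]) simp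
  moreover have "Suc (length (tl ?l)) = card C"
    using arg_cong[OF l, of length] by simp
  ultimately show "(case (hd ?l, tl ?l) of (i, I) \<Rightarrow> mon_seq n (rev I @ i # replicate (d - Suc (length I)) e) e)
      = padded n d e C"
    by (simp only: padded_def prod.case append_assoc append_Cons append_Nil flip: l')
next
  fix b assume b: "b \<in> N_set m"
  obtain i I where bI: "b = (i, I)" by (cases b)
  have I: "sorted_wrt (<) (i # I)" "1 \<le> i" "\<forall>j\<in>set (i # I). j \<le> m"
    using b by (auto simp: N_set_def bI)
  have "sorted (i # I)" "distinct (i # I)"
    using I(1) by (simp_all only: strict_sorted_iff)
  then have "sorted_list_of_set (set (i # I)) = i # I"
    by (rule sorted_list_of_set.idem_if_sorted_distinct)
  then show "(hd (sorted_list_of_set (case b of (i, I) \<Rightarrow> set (i # I))),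
      tl (sorted_list_of_set (case b of (i, I) \<Rightarrow> set (i # I)))) = b"
    by (simp only: bI prod.case list.sel)
  show "(case b of (i, I) \<Rightarrow> set (i # I)) \<in> Pow {1..m} - {{}}"
    using I by (fastforce simp: bI)
qed

text \<open>The summands of the claim lack \<open>n\<close> in row 0. \<open>seq_equiv_flip\<close>
  exchanges \<open>i\<close> with the block of \<open>n\<close>, which puts a single
  \<open>n\<close> right behind \<open>rev I\<close>, and \<open>seq_equiv_move\<close> relates this
  to the sequence with \<open>n\<close> in front.\<close>

lemma padded_rotate:
  assumes "(i, I) \<in> N_set (n - 1)" "n \<le> d"
  shows "mon_seq n (rev I @ i # replicate (d - Suc (length I)) n) n
       + mon_seq n (n # rev I @ replicate (d - Suc (length I)) i) n \<in> seq_space n d"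
proof -
  let ?k = "d - Suc (length I)"
  have I: "sorted_wrt (<) (i # I)" "1 \<le> i" "\<forall>j\<in>set (i # I). j \<le> n - 1" "length I < n - 1"
    using assms by (auto simp: N_set_def)
  then have sub: "set (rev I) \<subseteq> {1..n}" "i \<in> {1..n}" "n \<in> {1..n}"
    by (fastforce, auto)
  have k: "?k > 0" using I assms(2) by auto
  have 1: "seq_equiv n n (rev I @ i # replicate ?k n @ []) (rev I @ n # replicate ?k i @ [])"
    using I sub k by (intro seq_equiv_flip) auto
  have 2: "seq_equiv n n ([] @ n # rev I @ replicate ?k i) ([] @ rev I @ n # replicate ?k i)"
    using I sub by (intro seq_equiv_move) auto
  have "seq_equiv n n (rev I @ i # replicate ?k n) (n # rev I @ replicate ?k i)"
    using seq_equiv_trans[OF 1[simplified] seq_equiv_sym[OF 2[simplified]]] by simp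
  moreover have "length (rev I @ i # replicate ?k n) = d"
    using k by simp
  ultimately show ?thesis
    by (simp only: seq_equiv_def)
qed

text \<open>The empty prefix gives the left-hand side of the claim; the other prefixes are rewritten
  by \<open>padded_rotate\<close>.\<close>

lemma mon_seq_hit:
  assumes "n > 0" "n \<le> d"
  shows "mon_seq n (replicate d n) n
    + (\<Sum>(i, I)\<in>N_set (n - 1). mon_seq n (n # rev I @ replicate (d - Suc (length I)) i) n) \<in> seq_space n d"
proof -
  let ?a = "\<lambda>(i, I). mon_seq n (rev I @ i # replicate (d - Suc (length I)) n) n"
  let ?b = "\<lambda>(i, I). mon_seq n (n # rev I @ replicate (d - Suc (length I)) i) n"
  have "(\<Sum>C\<in>Pow {1..n-1}. padded n d n C) = padded n d n {} + (\<Sum>C\<in>Pow {1..n-1} - {{}}. padded n d n C)"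
    by (rule sum.remove) auto
  also have "padded n d n {} = mon_seq n (replicate d n) n"
    by (simp add: padded_def decr_def)
  finally have 1: "mon_seq n (replicate d n) n + sum ?a (N_set (n - 1)) \<in> seq_space n d"
    using sum_padded_last[OF assms] by (simp only: sum_padded_N_set)
  have "sum ?a (N_set (n - 1)) + sum ?b (N_set (n - 1)) = (\<Sum>x\<in>N_set (n - 1). ?a x + ?b x)"
    by (simp only: sum.distrib)
  also have "\<dots> \<in> seq_space n d"
    using padded_rotate[OF _ assms(2)] by (intro seq_space_sum) auto
  finally show ?thesis
    using 1 unfolding seq_space_def by (rule hit_space_trans[rotated])
qed

section \<open>The maps \<open>\<phi>\<close>\<close>

definition const_expo :: "nat set \<Rightarrow> nat \<Rightarrow> expo" where
  "const_expo A k = (\<Sum>j\<in>A. Poly_Mapping.single j k)"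

lemma const_expo_add: "const_expo A (k + l) = const_expo A k + const_expo A l"
  by (simp add: const_expo_def single_add sum.distrib)

lemma const_expo_remove: "finite A \<Longrightarrow> a \<in> A \<Longrightarrow> const_expo A k = Poly_Mapping.single a k + const_expo (A - {a}) k"
  by (simp add: const_expo_def sum.remove)

lemma mon_const_expo: "mon (const_expo A k) = (\<Prod>j\<in>A. var j ^ k)"
  by (simp add: const_expo_def mon_sum var_power)

lemma lookup_const_expo: "finite A \<Longrightarrow> Poly_Mapping.lookup (const_expo A k) j = (if j \<in> A then k else 0)"
  by (simp add: const_expo_def lookup_sum lookup_single when_def)

text \<open>Row \<open>t\<close> lacks only \<open>cs ! t\<close>, so adding \<open>2 ^ t\<close> to
  the exponent of that variable fills the row. The additive form avoids truncated subtraction of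
  exponents.\<close>

lemma dyad_complement:
  assumes "set cs \<subseteq> {1..n}"
  shows "dyad (map (\<lambda>c. {1..n} - {c}) cs @ [{e}]) + (\<Sum>t<length cs. Poly_Mapping.single (cs ! t) (2 ^ t))
    = const_expo {1..n} (2 ^ length cs - 1) + Poly_Mapping.single e (2 ^ length cs)"
  using assms
proof (induction cs)
  case Nil
  then show ?case by (simp add: ind_def const_expo_def)
next
  case (Cons c cs)
  let ?D = "dyad (map (\<lambda>c. {1..n} - {c}) cs @ [{e}])"
  let ?S = "\<Sum>t<length cs. Poly_Mapping.single (cs ! t) (2 ^ t) :: expo"
  let ?k = "2 ^ length cs - 1 :: nat"
  have S: "(\<Sum>t<length (c # cs). Poly_Mapping.single ((c # cs) ! t) (2 ^ t)) = Poly_Mapping.single c 1 + (?S + ?S)"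
    by (simp only: length_Cons sum.lessThan_Suc_shift) (simp add: mult_2 single_add sum.distrib)
  have ind: "ind ({1..n} - {c}) + Poly_Mapping.single c 1 = const_expo {1..n} 1"
    using Cons.prems const_expo_remove[of "{1..n}" c 1] by (simp add: ind_def const_expo_def add.commute)
  have "(2::nat) ^ length (c # cs) - 1 = 1 + (?k + ?k)"
    using one_le_power[of "2::nat" "length cs"] unfolding length_Cons power_Suc by arith
  then have ones: "const_expo {1..n} (2 ^ length (c # cs) - 1) = const_expo {1..n} 1 + (const_expo {1..n} ?k + const_expo {1..n} ?k)"
    by (simp only: const_expo_add)
  have regroup: "dyad (map (\<lambda>c. {1..n} - {c}) (c # cs) @ [{e}]) + (Poly_Mapping.single c 1 + (?S + ?S))
    = (ind ({1..n} - {c}) + Poly_Mapping.single c 1) + ((?D + ?S) + (?D + ?S))"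
    by (simp add: ac_simps)
  have IH: "?D + ?S = const_expo {1..n} ?k + Poly_Mapping.single e (2 ^ length cs)"
    using Cons by simp
  have "Poly_Mapping.single e (2 ^ length (c # cs)) = Poly_Mapping.single e (2 ^ length cs) + Poly_Mapping.single e (2 ^ length cs :: nat)"
    by (simp add: mult_2 flip: single_add)
  then show ?case
    unfolding S regroup ind IH ones by (simp only: ac_simps)
qed

text \<open>The constant tail contributes a geometric sum of powers of 2 to the exponent at
  \<open>i\<close>.\<close>

lemma sum_single_replicate:
  "(\<Sum>t<length as + m. Poly_Mapping.single ((as @ replicate m i) ! t) (2 ^ t)) =
   (\<Sum>t<length as. Poly_Mapping.single (as ! t) (2 ^ t))
     + Poly_Mapping.single i (2 ^ (length as + m) - 2 ^ length as :: nat)"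
proof (induction m)
  case (Suc m)
  let ?r = "length as"
  have nth: "(as @ replicate (Suc m) i) ! t = (as @ replicate m i) ! t" if "t < ?r + m" for t
    using that by (simp add: nth_append del: replicate_Suc)
  have last: "(as @ replicate (Suc m) i) ! (?r + m) = i"
    by (simp add: nth_append del: replicate_Suc)
  have "(\<Sum>t<?r + Suc m. Poly_Mapping.single ((as @ replicate (Suc m) i) ! t) (2 ^ t)) =
    (\<Sum>t<?r + m. Poly_Mapping.single ((as @ replicate m i) ! t) (2 ^ t)) + Poly_Mapping.single i (2 ^ (?r + m) :: nat)"
    by (simp add: nth last del: replicate_Suc cong: sum.cong_simp)
  also have "\<dots> = (\<Sum>t<?r. Poly_Mapping.single (as ! t) (2 ^ t)) +
      Poly_Mapping.single i ((2 ^ (?r + m) - 2 ^ ?r) + 2 ^ (?r + m))"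
    unfolding Suc single_add by (simp only: add.assoc)
  also have "(2::nat) ^ (?r + m) - 2 ^ ?r + 2 ^ (?r + m) = 2 ^ (?r + Suc m) - 2 ^ ?r"
  proof -
    have "(2::nat) ^ ?r \<le> 2 ^ (?r + m)" by simp
    then show ?thesis by simp
  qed
  finally show ?case .
qed simp

text \<open>The exponents of \<open>x_Iu J 1\<close> halve along \<open>J\<close>, hence double
  along \<open>rev J\<close>: dividing by this monomial takes the entries of \<open>rev J\<close>
  out of rows 0, 1, and so on.\<close>

lemma x_Iu_1:
  assumes "J \<noteq> []"
  shows "x_Iu J 1 = (\<Sum>t<length J. Poly_Mapping.single (rev J ! t) (2 ^ t))"
proof -
  let ?r = "length J"
  let ?f = "\<lambda>t. Poly_Mapping.single (J ! (t - 1)) (2 ^ (?r - t)) :: expo"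
  have "x_Iu J 1 = ?f 1 + sum ?f {1<..?r}"
    by (simp add: x_Iu_def Let_def)
  also have "\<dots> = sum ?f (insert 1 {1<..?r})"
    by simp
  also have "insert 1 {1<..?r} = {1..?r}"
    using assms by (auto simp: Suc_le_eq)
  also have "sum ?f {1..?r} = (\<Sum>t<?r. Poly_Mapping.single (rev J ! t) (2 ^ t))"
    by (rule sum.reindex_bij_witness[where i = "\<lambda>t. ?r - t" and j = "\<lambda>t. ?r - t"]) (auto simp: rev_nth)
  finally show ?thesis .
qed

lemma digit_ones: "k < d \<Longrightarrow> digit k (2 ^ d - 1) = 1"
  using bit_mask_iff[of d k, where ?'a = nat]
  by (simp add: digit_def mask_eq_exp_minus_1 bit_iff_odd odd_iff_mod_2_eq_one)

lemma f_map_const_expo: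
  assumes "i \<in> {1..n}" "k > 0"
  shows "f_map i (mon (const_expo {1..n-1} k)) = mon (const_expo ({1..n} - {i}) k)"
proof -
  have "Poly_Mapping.keys (const_expo {1..n-1} k) = {1..n-1}"
    using assms by (auto simp: in_keys_iff lookup_const_expo split: if_splits)
  then have "f_map i (mon (const_expo {1..n-1} k)) = (\<Prod>j\<in>{1..n-1}. (if j < i then var j else var (j + 1)) ^ k)"
    by (simp add: f_map_mon lookup_const_expo)
  also have "\<dots> = (\<Prod>j\<in>{1..n} - {i}. var j ^ k)"
    by (rule prod.reindex_bij_witness[where i = "\<lambda>j. if j < i then j else j - 1" and j = "\<lambda>j. if j < i then j else j + 1"])
       (use assms in auto)
  finally show ?thesis by (simp add: mon_const_expo)
qed

text \<open>This allows identities that involve division to be checked after multiplication by the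
  divisor.\<close>

lemma mon_mult_cancel: "f * mon e = g * mon e \<Longrightarrow> f = g"
proof -
  have "mon e \<noteq> 0" using keys_mon[of e] by (metis insert_not_empty keys_eq_empty)
  then show "f * mon e = g * mon e \<Longrightarrow> f = g" by simp
qed

lemma adjoin_greater:
  assumes "sorted_wrt (<) I" "\<forall>j\<in>set I. j < n"
  shows "adjoin I n = I @ [n]"
proof -
  have "sorted_wrt (<) (I @ [n])"
    using assms by (simp add: sorted_wrt_append)
  then have "sorted (I @ [n])" "distinct (I @ [n])"
    by (simp_all only: strict_sorted_iff)
  from sorted_list_of_set.idem_if_sorted_distinct[OF this] show ?thesis
    by (simp add: adjoin_def)
qed

lemma N_set_seq:
  assumes "(i, I) \<in> N_set (n - 1)" "n \<le> d"
  shows "set (n # rev I @ replicate (d - Suc (length I)) i) \<subseteq> {1..n}"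
    "length (n # rev I @ replicate (d - Suc (length I)) i) = d"
proof -
  have I: "1 \<le> i" "\<forall>j\<in>set I. i < j" "\<forall>j\<in>set (i # I). j \<le> n - 1" "length I < n - 1"
    using assms by (auto simp: N_set_def)
  have "j \<in> {1..n}" if "j \<in> set (n # i # I)" for j
    using that I by fastforce
  then show "set (n # rev I @ replicate (d - Suc (length I)) i) \<subseteq> {1..n}"
    by auto
  show "length (n # rev I @ replicate (d - Suc (length I)) i) = d"
    using I assms(2) by simp
qed

text \<open>Every exponent of the argument is \<open>2 ^ d - 1\<close>, whose \<open>d\<close>
  digits are all 1, and \<open>r < d\<close>, so \<open>u = 1\<close> is compatible. As
  \<open>n\<close> comes last in \<open>J\<close>, it is the variable missing from row 0; the
  exponent \<open>2 ^ r - 1\<close> of \<open>i\<close> leaves \<open>i\<close> missing from rows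
  \<open>r\<close> to \<open>d - 1\<close>.\<close>

lemma phi_ones:
  assumes I: "(i, I) \<in> N_set (n - 1)" and d: "n \<le> d"
  shows "phi i (adjoin I n) ((\<Prod>j = 1..n - 1. var j) ^ (2 ^ d - 1)) * var n ^ (2 ^ d)
    = mon_seq n (n # rev I @ replicate (d - Suc (length I)) i) n"
proof -
  define J where "J = I @ [n]"
  define K :: nat where "K = 2 ^ d - 1"
  define r where "r = length J"
  define m0 where "m0 = const_expo {1..n-1} K"
  let ?cs = "n # rev I @ replicate (d - Suc (length I)) i"
  have I': "sorted_wrt (<) (i # I)" "1 \<le> i" "\<forall>j\<in>set (i # I). j \<le> n - 1" "length I < n - 1"
    using I by (auto simp: N_set_def)
  then have lt: "\<forall>j\<in>set I. j < n" "\<forall>j\<in>set I. i < j" "i < n"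
    by auto
  have iJ: "sorted_wrt (<) (i # J)"
    using I' lt by (auto simp: J_def sorted_wrt_append)
  have r: "r = Suc (length I)" "r < d"
    using I' d by (auto simp: r_def J_def)
  have K: "K > 0"
    using r one_less_power[of "2::nat" d] by (simp add: K_def)
  have i: "i \<in> {1..n}"
    using lt I' by simp
  have adj: "adjoin I n = J"
    using I' lt unfolding J_def by (intro adjoin_greater) auto
  have X: "(\<Prod>j = 1..n - 1. var j) ^ K = mon m0"
    by (simp add: m0_def mon_const_expo prod_power_distrib)
  have \<nu>: "Poly_Mapping.lookup m0 (J ! (t - 1) - 1) = K" if "1 \<le> t" "t \<le> r" for t
  proof -
    have "J ! (t - 1) \<in> set J"
      using that by (intro nth_mem) (auto simp: r_def)
    then have "1 < J ! (t - 1)" "J ! (t - 1) \<le> n"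
      using iJ I' lt by (auto simp: J_def)
    then show ?thesis
      by (auto simp: m0_def lookup_const_expo)
  qed
  have "1 \<le> r" and \<nu>1: "Poly_Mapping.lookup m0 (J ! 0 - Suc 0) = K"
    using r(1) \<nu>[of 1] by simp_all
  have "(2::nat) ^ r < 2 ^ d"
    using r(2) by (rule power_strict_increasing) simp
  then have "2 ^ r - 1 < K" by (simp add: K_def diff_less_mono)
  moreover have dig: "digit (r - t) K = 1" if "1 \<le> t" "t \<le> r" for t
    using that r(2) unfolding K_def by (intro digit_ones) auto
  moreover have "digit (r - t) (Poly_Mapping.lookup m0 (J ! (t - 1) - 1)) = 1" if "1 < t" "t \<le> r" for t
    using that \<nu>[of t] dig[of t] by simp
  ultimately have comp: "compatible 1 J m0"
    using \<open>1 \<le> r\<close> by (auto simp: compatible_def Let_def \<nu>1 dig simp flip: r_def)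
  have phi: "phi i (adjoin I n) ((\<Prod>j = 1..n - 1. var j) ^ K) = phi_mon i J m0"
    unfolding X adj phi_def by simp
  \<comment> \<open>\<open>y\<close> collects the missing variables: \<open>x_Iu J 1\<close> for the
    rows below \<open>r\<close>, and \<open>i\<close> for the rows from \<open>r\<close> to
    \<open>d - 1\<close>. Both sides are compared after multiplication by
    \<open>mon y\<close>.\<close>
  define y where "y = Poly_Mapping.single i (2 ^ d - 2 ^ r) + x_Iu J 1"
  have "phi_mon i J m0 * var n ^ (2 ^ d) * mon y
    = (phi_mon i J m0 * mon (x_Iu J 1)) * (mon (Poly_Mapping.single i (2 ^ d - 2 ^ r)) * var n ^ (2 ^ d))"
    by (simp add: y_def mon_add mult_ac)
  also have "\<dots> = mon (Poly_Mapping.single i (2 ^ r - 1)) * mon (const_expo ({1..n} - {i}) K)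
      * (mon (Poly_Mapping.single i (2 ^ d - 2 ^ r)) * mon (Poly_Mapping.single n (2 ^ d)))"
    unfolding phi_mon_mult[OF iJ I'(2) comp] unfolding m0_def f_map_const_expo[OF i K]
    by (simp add: var_power r_def)
  also have "\<dots> = mon ((Poly_Mapping.single i ((2 ^ r - 1) + (2 ^ d - 2 ^ r)) + const_expo ({1..n} - {i}) K)
      + Poly_Mapping.single n (2 ^ d))"
    by (simp only: mon_add single_add mult_ac)
  also have "(2 ^ r - 1) + (2 ^ d - 2 ^ r) = K"
    using \<open>(2::nat) ^ r < 2 ^ d\<close> by (simp add: K_def)
  also have "Poly_Mapping.single i K + const_expo ({1..n} - {i}) K = const_expo {1..n} K"
    using lt I' const_expo_remove[of "{1..n}" i K] by simp
  also have "const_expo {1..n} K + Poly_Mapping.single n (2 ^ d) =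
      dyad (map (\<lambda>c. {1..n} - {c}) ?cs @ [{n}]) + (\<Sum>t<length ?cs. Poly_Mapping.single (?cs ! t) (2 ^ t))"
  proof -
    have "set ?cs \<subseteq> {1..n}" "length ?cs = d"
      using N_set_seq[OF I d] by auto
    then show ?thesis
      using dyad_complement[of ?cs n n] by (simp only: K_def)
  qed
  also have "(\<Sum>t<length ?cs. Poly_Mapping.single (?cs ! t) (2 ^ t)) = y"
    using sum_single_replicate[of "n # rev I" "d - r" i] x_Iu_1[of J] r
    by (simp add: y_def J_def add.commute)
  also have "mon (dyad (map (\<lambda>c. {1..n} - {c}) ?cs @ [{n}]) + y) = mon_seq n ?cs n * mon y"
    by (simp add: mon_seq_def mon_add)
  finally show ?thesis
    unfolding K_def[symmetric] phi by (rule mon_mult_cancel)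
qed

section \<open>Homogeneity, splitting of hits, and the final equivalence\<close>

lemma set_replicate_subset: "n > 0 \<Longrightarrow> set (replicate d n) \<subseteq> {1..n}" for n :: nat
  by (simp add: set_replicate_conv_if Suc_le_eq)

text \<open>All \<open>d\<close> rows lack \<open>n\<close>, so the factor \<open>mon ?y\<close>
  fills them at once and is then cancelled.\<close>

lemma mon_seq_XX:
  assumes "n > 0"
  shows "mon_seq n (replicate d n) n = XX n n ^ (2 ^ d - 1) * var n ^ (2 ^ d)"
proof (rule mon_mult_cancel)
  let ?D = "dyad (map (\<lambda>c. {1..n} - {c}) (replicate d n) @ [{n}])"
  let ?y = "Poly_Mapping.single n (2 ^ d - 1) :: expo"
  have "?D + ?y = const_expo {1..n} (2 ^ d - 1) + Poly_Mapping.single n (2 ^ d)"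
    using dyad_complement[OF set_replicate_subset[OF assms], of d n] sum_single_replicate[of "[]" d n] by simp
  also have "\<dots> = const_expo ({1..n} - {n}) (2 ^ d - 1) + Poly_Mapping.single n (2 ^ d) + ?y"
    using assms const_expo_remove[of "{1..n}" n "2 ^ d - 1"] by (simp add: ac_simps)
  finally have "mon (?D + ?y) = mon (const_expo ({1..n} - {n}) (2 ^ d - 1) + Poly_Mapping.single n (2 ^ d) + ?y)"
    by simp
  then show "mon_seq n (replicate d n) n * mon ?y = XX n n ^ (2 ^ d - 1) * var n ^ (2 ^ d) * mon ?y"
    by (simp only: mon_add mon_seq_def mon_const_expo XX_def prod_power_distrib var_power)
qed

lemma mon_seq_hom_P:
  assumes "set cs \<subseteq> {1..n}" "n > 0"
  shows "mon_seq n cs n \<in> hom_P n (mdeg (dyad (map (\<lambda>c. {1..n} - {c}) (replicate (length cs) n) @ [{n}])))"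
proof -
  have "weight (dyad (map (\<lambda>c. {1..n} - {c}) cs @ [{n}]))
      = weight (dyad (map (\<lambda>c. {1..n} - {c}) (replicate (length cs) n) @ [{n}]))"
    using assms by (intro weight_seq set_replicate_subset) auto
  then show ?thesis
    using assms keys_dyad[OF rows_in_lists[of n n cs]] by (simp add: mon_seq_def hom_P_mon flip: wdeg_weight)
qed

text \<open>The span of a union is the sum of the spans.\<close>

lemma hit_space_split:
  assumes "f \<in> hit_space n s m0"
  shows "f \<in> {a + b | a b. a \<in> A_plus_P s n \<and> b \<in> P_minus n (weight m0)}"
proof -
  have "hits n s m0 \<subseteq> {Sq j f | j f. 1 \<le> j \<and> j < 2 ^ s \<and> f \<in> P n}"
    by (force simp: hits_def P_def)
  then have "F2.span (hits n s m0) \<subseteq> A_plus_P s n"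
    unfolding A_plus_P_def by (rule F2.span_mono)
  moreover have "smaller n m0 \<subseteq> {mon m | m. mon m \<in> P n \<and> mdeg m = wdeg (weight m0) \<and> weight m < weight m0}"
    by (force simp: smaller_def P_def wdeg_weight)
  then have "F2.span (smaller n m0) \<subseteq> P_minus n (weight m0)"
    unfolding P_minus_def by (rule F2.span_mono)
  ultimately show ?thesis
    using assms unfolding hit_space_def F2.span_Un by blast
qed

theorem proposition3p11:
  fixes d n :: nat
  assumes "2 \<le> n" and "n \<le> d"
  shows "equiv_mon n n (XX n n ^ (2 ^ d - 1) * var n ^ (2 ^ d))
    (\<Sum>(i, I) \<in> N_set (n - 1).
       phi i (adjoin I n) ((\<Prod>j = 1..n - 1. var j) ^ (2 ^ d - 1)) * var n ^ (2 ^ d))"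
proof -
  let ?m = "dyad (map (\<lambda>c. {1..n} - {c}) (replicate d n) @ [{n}])"
  let ?f = "mon_seq n (replicate d n) n"
  let ?g = "\<Sum>(i, I)\<in>N_set (n - 1). mon_seq n (n # rev I @ replicate (d - Suc (length I)) i) n"
  have n: "n > 0" using assms by simp
  have "?f \<in> hom_P n (mdeg ?m)"
    using mon_seq_hom_P[OF set_replicate_subset[OF n] n, of d] by simp
  moreover have "?g \<in> hom_P n (mdeg ?m)"
  proof (rule hom_P_sum, clarify)
    fix i I assume iI: "(i, I) \<in> N_set (n - 1)"
    let ?cs = "n # rev I @ replicate (d - Suc (length I)) i"
    have "length ?cs = d" "set ?cs \<subseteq> {1..n}"
      using N_set_seq[OF iI assms(2)] by auto
    then show "mon_seq n ?cs n \<in> hom_P n (mdeg ?m)"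
      using mon_seq_hom_P[of ?cs n] n by (simp only:)
  qed
  \<comment> \<open>Over the field with two elements the difference is the sum treated in
    \<open>mon_seq_hit\<close>.\<close>
  moreover have "?f - ?g \<in> {a + b | a b. a \<in> A_plus_P n n \<and> b \<in> P_minus n (weight ?m)}"
    using mon_seq_hit[OF n assms(2)] unfolding mpoly2_diff seq_space_def by (rule hit_space_split)
  ultimately have "equiv_weight n n (weight ?m) ?f ?g"
    unfolding equiv_weight_def by (auto simp: hom_P_def)
  then have "equiv_mon n n ?f ?g"
    unfolding equiv_mon_def mon_seq_def by blast
  moreover have "?g = (\<Sum>(i, I) \<in> N_set (n - 1).
       phi i (adjoin I n) ((\<Prod>j = 1..n - 1. var j) ^ (2 ^ d - 1)) * var n ^ (2 ^ d))"
    using phi_ones[OF _ assms(2)] by (intro sum.cong) auto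
  ultimately show ?thesis
    by (simp only: mon_seq_XX[OF n])
qed

end
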